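(* For every nonnegative integer $n$, the number of signed partitions $\sigma=(\pi,\nu)$ of $n+2$ such that (i) $\pi_1$, the largest positive part, is even, (ii) the integers $1,2,\dots,\frac{\pi_1}{2}-1$ all appear as positive parts an even number of times and at least twice, (iii) the integer $\frac{\pi_1}{2}$ does not appear as a positive part, (iv) the integers $\frac{\pi_1}{2}+1,\frac{\pi_1}{2}+2,\dots,\pi_1$ all appear as positive parts at least once, and (v) there are exactly $\frac{\pi_1}{2}-1$ negative parts (counted with multiplicity), each $\equiv 1\pmod 3$ and $\leq \frac{3\pi_1}{2}-2$, with the negative parts greater than $1$ occurring at most once, equals the number of (ordinary) partitions of $n$ into parts congruent to $\pm 2, \pm 3, \pm 6, \pm 7, \pm 8 \pmod{18}$.
   Context: A partition $\lambda$ of length $\ell=\ell(\lambda)$ is an $\ell$-tuple $(\lambda_1,\dots,\lambda_\ell)$ of positive integers (its parts) with $\lambda_i\geq\lambda_{i+1}$ for $1\le i\le \ell-1$; its weight is $|\lambda|=\sum_i\lambda_i$, and it is a partition of $n$ if $|\lambda|=n$. The empty partition (length $0$, weight $0$) is allowed. A signed partition $\sigma$ of an integer $n$ is a pair $(\pi,\nu)$ of partitions with $n=|\pi|-|\nu|$; the parts of $\pi$ are called the positive parts of $\sigma$ and the parts of $\nu$ (which are positive integers) are called the negative parts of $\sigma$. In the claim $\pi$ is nonempty (it has a largest part $\pi_1$), while $\nu$ may be empty; a list of integers such as $1,2,\dots,\frac{\pi_1}{2}-1$ is empty when its upper end is $0$. *)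

theory Defs
  imports "HOL-Number_Theory.Cong"
begin

text \<open>A partition is the list of its parts in weakly decreasing order; its length and weight are
  \<open>length\<close> and \<open>sum_list\<close>, and its largest part, if it is nonempty, is \<open>hd\<close>.\<close>

definition is_partition :: "nat list \<Rightarrow> bool" where
  "is_partition p \<longleftrightarrow> sorted_wrt (\<ge>) p \<and> (\<forall>x\<in>set p. 0 < x)"

definition partition_of :: "nat \<Rightarrow> nat list \<Rightarrow> bool" where
  "partition_of n p \<longleftrightarrow> is_partition p \<and> sum_list p = n"

fun signed_partition_of :: "int \<Rightarrow> nat list \<times> nat list \<Rightarrow> bool" where
  "signed_partition_of n (\<pi>, \<nu>) \<longleftrightarrow>
     is_partition \<pi> \<and> is_partition \<nu> \<and> n = int (sum_list \<pi>) - int (sum_list \<nu>)"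

text \<open>For a nonempty partition \<open>\<pi>\<close> with even largest part, \<open>hd \<pi> div 2\<close> is positive, so no
  subtraction below is truncated.\<close>

fun admissible :: "nat list \<times> nat list \<Rightarrow> bool" where
  "admissible (\<pi>, \<nu>) \<longleftrightarrow>
     \<pi> \<noteq> [] \<and>
     even (hd \<pi>) \<and>
     (\<forall>i\<in>{1..hd \<pi> div 2 - 1}. even (count_list \<pi> i) \<and> 2 \<le> count_list \<pi> i) \<and>
     hd \<pi> div 2 \<notin> set \<pi> \<and>
     (\<forall>i\<in>{hd \<pi> div 2 + 1..hd \<pi>}. 1 \<le> count_list \<pi> i) \<and>
     length \<nu> = hd \<pi> div 2 - 1 \<and>
     (\<forall>x\<in>set \<nu>. [x = 1] (mod 3) \<and> x \<le> 3 * hd \<pi> div 2 - 2) \<and>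
     (\<forall>x\<in>set \<nu>. 1 < x \<longrightarrow> count_list \<nu> x \<le> 1)"

definition allowed_part :: "nat \<Rightarrow> bool" where
  "allowed_part x \<longleftrightarrow>
     (\<exists>r\<in>{2, 3, 6, 7, 8}. [int x = r] (mod 18) \<or> [int x = - r] (mod 18))"

end

theory Submission
  imports Defs Complex_Main "HOL-Computational_Algebra.Formal_Power_Series" "HOL-Library.Multiset"
begin

unbundle fps_syntax

text \<open>Let \<open>\<pi>\<^sub>1 = 2 k\<close>. The negative parts are the set \<open>{4, 7, \<dots>, 3 k - 2}\<close> with some members
  \<open>3 j + 1\<close> (those with \<open>j \<in> T\<close>) replaced by ones, so that \<open>\<nu>\<close> is encoded by a set
  \<open>T \<subseteq> {1..<k}\<close>, and \<open>|\<nu>|\<close> falls short of the fixed total \<open>4 + 7 + \<dots> + (3 k - 2)\<close> by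
  \<open>3 \<Sum>T\<close>. With this shift no negative exponents occur, and the signed partitions of \<open>n + 2\<close> with
  \<open>\<pi>\<^sub>1 = 2 k\<close> are counted by the coefficient of \<open>q\<^sup>n\<close> in
  \<open>q^(k\<^sup>2 - 1) \<Prod>\<^sub>j\<^sub><\<^sub>k (1 + q^(3j)) / (\<Prod>\<^sub>j\<^sub><\<^sub>k (1 - q^(2j)) \<Prod>\<^sub>k\<^sub><\<^sub>i\<^sub>\<le>\<^sub>2\<^sub>k (1 - q^i))
   = q^(k\<^sup>2 - 1) (1 - q^k) P / (q; q)\<^sub>2\<^sub>k\<close>, where \<open>P = \<Prod>\<^sub>j\<^sub><\<^sub>k (1 - q^j + q^(2j))\<close>.

  The sum of these series over \<open>k \<ge> 1\<close> is evaluated by a Bailey pair. Since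
  \<open>1 - x + x\<^sup>2 = (1 + \<omega> x) (1 + \<omega>\<^sup>2 x)\<close> for a primitive cube root of unity \<open>\<omega>\<close>, the finite form of
  the Jacobi triple product expands \<open>(1 - q^k) P / (q; q)\<^sub>2\<^sub>k\<close> into
  \<open>\<Sum>\<^sub>r \<chi>(r) q^(r(r-1)/2) / ((q; q)\<^sub>k\<^sub>-\<^sub>r (q; q)\<^sub>k\<^sub>+\<^sub>r)\<close>, where \<open>\<chi>\<close> is the nontrivial character
  modulo 3 (\<open>cubic_poly_expansion\<close>). Exchanging the summations leaves sums over Durfee rectangles
  (\<open>durfee_rectangle_sum\<close>), and in the limit the total is
  \<open>\<Sum>\<^sub>r \<chi>(r) q^((3r\<^sup>2 - r - 2)/2) / (q; q)\<^sub>\<infinity>\<close> (\<open>signed_series_theta\<close>).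

  This theta series is the product of \<open>1 - q^i\<close> over all \<open>i\<close> that are not allowed as parts, by an
  instance of the quintuple product identity (\<open>quintuple_product_mod_18\<close>). It is
  obtained by multiplying two triple products, sorting the terms of the double sum by a residue
  modulo 3, and recognising the inner sums as Euler's pentagonal number series or as sums that
  cancel in pairs. Dividing by \<open>(q; q)\<^sub>\<infinity>\<close> leaves the generating function of the partitions into
  allowed parts.

  All series are formal power series over the complex numbers, and every infinite sum or
  product is a limit in their coefficientwise topology.\<close>

section \<open>Limits and Euler products of formal power series\<close>

lemma tendsto_mult_fps:
  fixes f g :: "'b \<Rightarrow> 'a::ring_1 fps"
  assumes "(f \<longlongrightarrow> F) net" "(g \<longlongrightarrow> G) net"
  shows "((\<lambda>x. f x * g x) \<longlongrightarrow> F * G) net"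
proof (rule tendsto_fpsI)
  fix n
  have "eventually (\<lambda>x. \<forall>i\<in>{..n}. f x $ i = F $ i \<and> g x $ i = G $ i) net"
    using assms by (subst eventually_ball_finite_distrib) (auto simp: tendsto_fps_iff eventually_conj)
  then show "eventually (\<lambda>x. (f x * g x) $ n = (F * G) $ n) net"
    by eventually_elim (auto simp: fps_mult_nth intro!: sum.cong)
qed

text \<open>The product of \<open>1 - q^i\<close> over a possibly infinite set \<open>S\<close> of positive integers. Factors with
  \<open>i > n\<close> do not affect the coefficient of \<open>q\<^sup>n\<close>, so each coefficient is read off from a finite
  product.\<close>

definition euler_prod :: "nat set \<Rightarrow> complex fps" where
  "euler_prod S = Abs_fps (\<lambda>n. (\<Prod>i\<in>S \<inter> {1..n}. 1 - fps_X ^ i) $ n)"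

lemma prod_one_minus_X_power_nth:
  fixes f :: "complex fps"
  assumes "finite F" "\<And>i. i \<in> F \<Longrightarrow> n < i"
  shows "(f * (\<Prod>i\<in>F. 1 - fps_X ^ i)) $ n = f $ n"
  using assms
proof (induction F arbitrary: f rule: finite_induct)
  case (insert x F)
  have "(f * (\<Prod>i\<in>insert x F. 1 - fps_X ^ i)) $ n = ((f * (1 - fps_X ^ x)) * (\<Prod>i\<in>F. 1 - fps_X ^ i)) $ n"
    using insert.hyps by (simp add: mult_ac)
  also have "\<dots> = (f * (1 - fps_X ^ x)) $ n"
    using insert by simp
  also have "\<dots> = f $ n"
    using insert.prems[of x] by (simp add: algebra_simps fps_X_power_mult_right_nth)
  finally show ?case .
qed simp

lemma tendsto_euler_prod:
  assumes "\<And>N. finite (F N)" "\<And>N. F N \<subseteq> S" "0 \<notin> S"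
    and "\<And>i. i \<in> S \<Longrightarrow> eventually (\<lambda>N. i \<in> F N) net"
  shows "((\<lambda>N. \<Prod>i\<in>F N. 1 - fps_X ^ i) \<longlongrightarrow> euler_prod S) net"
proof (rule tendsto_fpsI)
  fix n
  have "eventually (\<lambda>N. \<forall>i\<in>S \<inter> {1..n}. i \<in> F N) net"
    using assms(4) by (subst eventually_ball_finite_distrib) auto
  then show "eventually (\<lambda>N. (\<Prod>i\<in>F N. 1 - fps_X ^ i) $ n = euler_prod S $ n) net"
  proof eventually_elim
    case (elim N)
    have "F N = (S \<inter> {1..n}) \<union> (F N - {..n})"
      using elim assms(2)[of N] assms(3) by (auto simp: Suc_le_eq) (metis gr0I subsetD)
    then have "(\<Prod>i\<in>F N. 1 - fps_X ^ i :: complex fps)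
        = (\<Prod>i\<in>S \<inter> {1..n}. 1 - fps_X ^ i) * (\<Prod>i\<in>F N - {..n}. 1 - fps_X ^ i)"
      using assms(1)[of N] by (subst prod.union_disjoint[symmetric]) auto
    then show ?case
      using assms(1)[of N]
      by (simp only: euler_prod_def fps_nth_Abs_fps) (rule prod_one_minus_X_power_nth, auto)
  qed
qed

lemma euler_prod_Un:
  assumes "S \<inter> T = {}" "0 \<notin> S" "0 \<notin> T"
  shows "euler_prod (S \<union> T) = euler_prod S * euler_prod T"
proof (rule LIMSEQ_unique)
  have ev: "eventually (\<lambda>N. i \<in> U \<inter> {1..N}) sequentially" if "i \<in> U" "0 \<notin> U" for i :: nat and U
    using that by (intro eventually_sequentiallyI[of i]) (auto simp: Suc_le_eq intro: gr0I)
  show "(\<lambda>N. \<Prod>i\<in>(S \<union> T) \<inter> {1..N}. 1 - fps_X ^ i) \<longlonglongrightarrow> euler_prod (S \<union> T)"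
    by (rule tendsto_euler_prod) (use assms ev in auto)
  have "(\<lambda>N. (\<Prod>i\<in>S \<inter> {1..N}. 1 - fps_X ^ i) * (\<Prod>i\<in>T \<inter> {1..N}. 1 - fps_X ^ i))
      \<longlonglongrightarrow> euler_prod S * euler_prod T"
    by (intro tendsto_mult_fps tendsto_euler_prod) (use assms ev in auto)
  moreover have "(\<Prod>i\<in>(S \<union> T) \<inter> {1..N}. 1 - fps_X ^ i :: complex fps)
      = (\<Prod>i\<in>S \<inter> {1..N}. 1 - fps_X ^ i) * (\<Prod>i\<in>T \<inter> {1..N}. 1 - fps_X ^ i)" for N
    using assms(1) by (subst prod.union_disjoint[symmetric]) (auto simp: Int_Un_distrib2)
  ultimately show "(\<lambda>N. \<Prod>i\<in>(S \<union> T) \<inter> {1..N}. 1 - fps_X ^ i) \<longlonglongrightarrow> euler_prod S * euler_prod T"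
    by simp
qed

lemma euler_prod_nth_0 [simp]: "euler_prod S $ 0 = 1"
  by (simp add: euler_prod_def)

lemma euler_prod_nonzero [simp]: "euler_prod S \<noteq> 0"
  using euler_prod_nth_0[of S] by (metis fps_zero_nth zero_neq_one)

section \<open>Generating functions of weighted sets\<close>

definition gf :: "('i \<Rightarrow> nat) \<Rightarrow> ('i \<Rightarrow> complex) \<Rightarrow> 'i set \<Rightarrow> complex fps" where
  "gf w s A = Abs_fps (\<lambda>n. \<Sum>i\<in>{i\<in>A. w i = n}. s i)"

text \<open>Finitely many indices of each weight: the condition under which the coefficients of a generating
  function are genuine sums and infinite index sets may be split and multiplied.\<close>

definition fin_fibers :: "('i \<Rightarrow> nat) \<Rightarrow> 'i set \<Rightarrow> bool" where
  "fin_fibers w A \<longleftrightarrow> (\<forall>n. finite {i\<in>A. w i = n})"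

lemma fin_fibers_le: "fin_fibers w A \<Longrightarrow> finite {i\<in>A. w i \<le> n}"
proof -
  assume "fin_fibers w A"
  moreover have "{i\<in>A. w i \<le> n} = (\<Union>m\<le>n. {i\<in>A. w i = m})" by auto
  ultimately show ?thesis by (auto simp: fin_fibers_def)
qed

lemma fin_fibersI: "(\<And>n. finite {i\<in>A. w i \<le> n}) \<Longrightarrow> fin_fibers w A"
  unfolding fin_fibers_def
proof
  fix n
  assume "\<And>n. finite {i\<in>A. w i \<le> n}"
  then show "finite {i\<in>A. w i = n}" by (rule finite_subset[rotated, of "{i\<in>A. w i \<le> n}"]) auto
qed

lemma fin_fibers_subset: "fin_fibers w A \<Longrightarrow> B \<subseteq> A \<Longrightarrow> fin_fibers w B"
  unfolding fin_fibers_def by (auto elim!: finite_subset[rotated])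

lemma fin_fibers_bij:
  assumes "bij_betw f A B" "\<And>i. i \<in> A \<Longrightarrow> w i = v (f i)" "fin_fibers w A"
  shows "fin_fibers v B"
  unfolding fin_fibers_def
proof
  fix n
  have "{j \<in> B. v j = n} \<subseteq> f ` {i \<in> A. w i = n}"
    using assms(1,2) by (auto simp: bij_betw_def)
  then show "finite {j \<in> B. v j = n}"
    by (rule finite_subset) (use assms(3) in \<open>auto simp: fin_fibers_def\<close>)
qed

lemma fin_fibers_abs_le:
  assumes "\<And>k :: int. k \<in> A \<Longrightarrow> nat \<bar>k\<bar> \<le> w k + c"
  shows "fin_fibers w A"
proof (rule fin_fibersI)
  fix n
  have "{k \<in> A. w k \<le> n} \<subseteq> {- int (n + c)..int (n + c)}"
    using assms by fastforce
  then show "finite {k \<in> A. w k \<le> n}" by (rule finite_subset) simp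
qed

lemma gf_nth: "gf w s A $ n = (\<Sum>i\<in>{i\<in>A. w i = n}. s i)"
  by (simp add: gf_def)

lemma gf_count: "gf w (\<lambda>_. 1) A $ n = of_nat (card {i\<in>A. w i = n})"
  by (simp add: gf_def)

lemma gf_zero: "(\<And>i. i \<in> A \<Longrightarrow> s i = 0) \<Longrightarrow> gf w s A = 0"
  by (rule fps_ext) (simp add: gf_nth)

lemma gf_uminus: "gf w (\<lambda>i. - s i) A = - gf w s A"
  by (rule fps_ext) (simp add: gf_nth sum_negf)

lemma gf_finite:
  assumes "finite A"
  shows "gf w s A = (\<Sum>i\<in>A. fps_const (s i) * fps_X ^ w i)"
proof (rule fps_ext)
  fix n
  have "(\<Sum>i\<in>A. fps_const (s i) * fps_X ^ w i) $ n = (\<Sum>i\<in>A. if w i = n then s i else 0)"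
    unfolding fps_sum_nth by (rule sum.cong) auto
  then show "gf w s A $ n = (\<Sum>i\<in>A. fps_const (s i) * fps_X ^ w i) $ n"
    using assms by (simp add: gf_nth sum.inter_filter)
qed

lemma gf_reindex:
  assumes "bij_betw f A B" "\<And>i. i \<in> A \<Longrightarrow> w i = v (f i)" "\<And>i. i \<in> A \<Longrightarrow> s i = t (f i)"
  shows "gf w s A = gf v t B"
proof (rule fps_ext)
  fix n
  have "bij_betw f {i\<in>A. w i = n} {j\<in>B. v j = n}"
    using assms(1,2) by (auto simp: bij_betw_def inj_on_def image_iff)
  from sum.reindex_bij_betw[OF this, of t] show "gf w s A $ n = gf v t B $ n"
    by (simp add: gf_nth assms(3))
qed

text \<open>The involution principle: the terms cancel in pairs.\<close>

lemma gf_sign_reversing: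
  assumes "bij_betw f A A" "\<And>i. i \<in> A \<Longrightarrow> w (f i) = w i" "\<And>i. i \<in> A \<Longrightarrow> s (f i) = - s i"
  shows "gf w s A = 0"
proof -
  have "gf w s A = gf w (\<lambda>i. - s i) A"
    by (rule gf_reindex[OF assms(1)]) (simp_all add: assms(2,3))
  then have "gf w s A + gf w s A = 0" by (simp add: gf_uminus)
  then have "2 * gf w s A = 0" by (simp only: mult_2)
  then show ?thesis by simp
qed

lemma gf_shift: "gf (\<lambda>i. w i + d) s A = fps_X ^ d * gf w s A"
proof (rule fps_ext)
  fix n
  show "gf (\<lambda>i. w i + d) s A $ n = (fps_X ^ d * gf w s A) $ n"
  proof (cases "n < d")
    case True
    then have none: "{i \<in> A. w i + d = n} = {}" by auto
    show ?thesis unfolding gf_nth none using True by (simp add: fps_X_power_mult_nth)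
  next
    case False
    then have "{i \<in> A. w i + d = n} = {i \<in> A. w i = n - d}" by auto
    then show ?thesis using False by (simp add: fps_X_power_mult_nth gf_nth)
  qed
qed

lemma gf_Un:
  assumes "A \<inter> B = {}" "fin_fibers w A" "fin_fibers w B"
  shows "gf w s (A \<union> B) = gf w s A + gf w s B"
proof (rule fps_ext)
  fix n
  have "{i \<in> A \<union> B. w i = n} = {i\<in>A. w i = n} \<union> {i\<in>B. w i = n}" by auto
  then show "gf w s (A \<union> B) $ n = (gf w s A + gf w s B) $ n"
    using assms by (simp add: gf_nth fin_fibers_def) (subst sum.union_disjoint, auto)
qed

lemma gf_times_aux:
  fixes w :: "'i \<Rightarrow> nat" and v :: "'j \<Rightarrow> nat"
  shows
  "{p \<in> A \<times> B. (case p of (i, j) \<Rightarrow> w i + v j) = n}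
     = (\<Union>m\<le>n. {i\<in>A. w i = m} \<times> {j\<in>B. v j = n - m})"
  by auto

lemma fin_fibers_Times:
  assumes "fin_fibers w A" "fin_fibers v B"
  shows "fin_fibers (\<lambda>(i, j). w i + v j) (A \<times> B)"
  using assms unfolding fin_fibers_def gf_times_aux by auto

text \<open>Weights add on pairs, so the coefficients of \<open>q\<^sup>n\<close> are convolutions; a fibre of the product is
  a finite union of products of fibres.\<close>

lemma gf_Times:
  assumes "fin_fibers w A" "fin_fibers v B"
  shows "gf (\<lambda>(i, j). w i + v j) (\<lambda>(i, j). s i * t j) (A \<times> B) = gf w s A * gf v t B"
proof (rule fps_ext)
  fix n
  have "gf (\<lambda>(i, j). w i + v j) (\<lambda>(i, j). s i * t j) (A \<times> B) $ n =
      (\<Sum>m\<le>n. \<Sum>(i, j)\<in>{i\<in>A. w i = m} \<times> {j\<in>B. v j = n - m}. s i * t j)"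
    unfolding gf_nth gf_times_aux
    by (rule sum.UNION_disjoint) (use assms in \<open>auto simp: fin_fibers_def\<close>)
  also have "\<dots> = (gf w s A * gf v t B) $ n"
    by (simp add: fps_mult_nth gf_nth sum_product sum.cartesian_product atLeast0AtMost)
  finally show "gf (\<lambda>(i, j). w i + v j) (\<lambda>(i, j). s i * t j) (A \<times> B) $ n = (gf w s A * gf v t B) $ n" .
qed

text \<open>Expanding the product means choosing the set of factors that contribute their monomial.\<close>

lemma gf_Pow:
  assumes "finite A"
  shows "gf (\<lambda>T. \<Sum>j\<in>T. w j) (\<lambda>_. 1) (Pow A) = (\<Prod>j\<in>A. 1 + fps_X ^ w j)"
  using prod_add[OF assms, of "\<lambda>j. fps_X ^ w j :: complex fps" "\<lambda>_. 1"] assms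
  by (simp add: gf_finite power_sum add.commute)

lemma tendsto_gf:
  assumes "fin_fibers w A" "\<And>N. finite (F N)" "\<And>N. F N \<subseteq> A"
    and "\<And>i. i \<in> A \<Longrightarrow> eventually (\<lambda>N. i \<in> F N) net"
  shows "((\<lambda>N. \<Sum>i\<in>F N. fps_X ^ w i * fps_const (s i)) \<longlongrightarrow> gf w s A) net"
proof (rule tendsto_fpsI)
  fix n
  have "eventually (\<lambda>N. \<forall>i\<in>{i\<in>A. w i = n}. i \<in> F N) net"
    using assms by (subst eventually_ball_finite_distrib) (auto simp: fin_fibers_def)
  then show "eventually (\<lambda>N. (\<Sum>i\<in>F N. fps_X ^ w i * fps_const (s i)) $ n = gf w s A $ n) net"
  proof eventually_elim
    case (elim N)
    then have eq: "{i\<in>A. w i = n} = {i\<in>F N. w i = n}" using assms(3)[of N] by auto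
    have "(\<Sum>i\<in>F N. fps_X ^ w i * fps_const (s i)) = gf w s (F N)"
      using assms(2) by (simp add: gf_finite mult.commute)
    then show ?case by (simp add: gf_nth eq)
  qed
qed

text \<open>The formal counterpart of Tannery's theorem. Only the finitely many indices of weight at most
  \<open>n\<close> affect the coefficient of \<open>q\<^sup>n\<close>, and for these the factors \<open>c N i\<close> eventually agree with
  their limits up to that degree. The limit \<open>S\<close> of the sum with the limiting factors is a
  hypothesis, because it is supplied by different means in each application.\<close>

lemma tannery_fps:
  fixes c :: "'n \<Rightarrow> 'i \<Rightarrow> complex fps"
  assumes "fin_fibers w A" "\<And>N. finite (F N)" "\<And>N. F N \<subseteq> A"
    and c: "\<And>i. i \<in> A \<Longrightarrow> ((\<lambda>N. c N i) \<longlongrightarrow> C i) net"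
    and S: "((\<lambda>N. \<Sum>i\<in>F N. fps_X ^ w i * C i) \<longlongrightarrow> S) net"
  shows "((\<lambda>N. \<Sum>i\<in>F N. fps_X ^ w i * c N i) \<longlongrightarrow> S) net"
proof (rule tendsto_fpsI)
  fix n
  have "eventually (\<lambda>N. \<forall>m\<in>{..n}. c N i $ m = C i $ m) net" if "i \<in> A" for i
    using c[OF that] by (intro eventually_ball_finite) (auto simp: tendsto_fps_iff)
  then have "eventually (\<lambda>N. \<forall>i\<in>{i\<in>A. w i \<le> n}. \<forall>m\<in>{..n}. c N i $ m = C i $ m) net"
    by (intro eventually_ball_finite fin_fibers_le[OF assms(1)]) blast
  moreover have "eventually (\<lambda>N. (\<Sum>i\<in>F N. fps_X ^ w i * C i) $ n = S $ n) net"
    using S by (simp add: tendsto_fps_iff)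
  ultimately show "eventually (\<lambda>N. (\<Sum>i\<in>F N. fps_X ^ w i * c N i) $ n = S $ n) net"
  proof eventually_elim
    case (elim N)
    have "(\<Sum>i\<in>F N. fps_X ^ w i * c N i) $ n = (\<Sum>i\<in>F N. fps_X ^ w i * C i) $ n"
      unfolding fps_sum_nth
    proof (rule sum.cong)
      fix i assume "i \<in> F N"
      with assms(3) have "i \<in> A" by blast
      with elim(1) show "(fps_X ^ w i * c N i) $ n = (fps_X ^ w i * C i) $ n"
        by (auto simp: fps_X_power_mult_nth not_less)
    qed simp
    with elim(2) show ?case by simp
  qed
qed

section \<open>The finite Jacobi triple product and Durfee rectangles\<close>

definition qpoch :: "complex fps \<Rightarrow> nat \<Rightarrow> complex fps" where
  "qpoch q n = (\<Prod>i\<in>{1..n}. 1 - q ^ i)"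

text \<open>The reciprocal of \<open>(q; q)\<^sub>j\<close>, with the usual convention that it vanishes for negative \<open>j\<close>. This
  makes the recurrence \<open>inv_qpoch_step\<close> hold at \<open>j = 0\<close> as well, so sums over binomial-like terms
  can be extended or shifted without boundary terms.\<close>

definition inv_qpoch :: "complex fps \<Rightarrow> int \<Rightarrow> complex fps" where
  "inv_qpoch q j = (if j < 0 then 0 else inverse (qpoch q (nat j)))"

lemma qpoch_Suc: "qpoch q (Suc n) = (1 - q ^ Suc n) * qpoch q n"
  by (simp add: qpoch_def mult.commute)

lemma qpoch_nth_0: "q $ 0 = 0 \<Longrightarrow> qpoch q n $ 0 = 1"
  by (induction n) (simp_all add: qpoch_Suc fps_nth_power_0, simp add: qpoch_def)

lemma qpoch_inverse: "q $ 0 = 0 \<Longrightarrow> qpoch q n * inverse (qpoch q n) = 1"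
  by (rule inverse_mult_eq_1') (simp add: qpoch_nth_0)

lemma inv_qpoch_neg: "j < 0 \<Longrightarrow> inv_qpoch q j = 0"
  by (simp add: inv_qpoch_def)

lemma inv_qpoch_nonzeroD: "inv_qpoch q j \<noteq> 0 \<Longrightarrow> 0 \<le> j"
  using inv_qpoch_neg[of j q] by linarith

lemma inv_qpoch_0 [simp]: "inv_qpoch q 0 = 1"
  by (simp add: inv_qpoch_def qpoch_def)

lemma inv_qpoch_nat: "inv_qpoch q (int n) = inverse (qpoch q n)"
  by (simp add: inv_qpoch_def)

lemma inv_qpoch_step:
  assumes "q $ 0 = 0" "j \<ge> 0"
  shows "inv_qpoch q (j - 1) = (1 - q ^ nat j) * inv_qpoch q j"
proof (cases "j = 0")
  case False
  then obtain n where j: "j = int (Suc n)"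
    using assms(2) by (metis nat_0_le not0_implies_Suc of_nat_0)
  have "inverse (qpoch q n) = (1 - q ^ Suc n) * inverse (qpoch q (Suc n))"
  proof -
    have "(1 - q ^ Suc n) * inverse (1 - q ^ Suc n) = 1"
      using assms(1) by (intro inverse_mult_eq_1') (simp add: fps_nth_power_0)
    then show ?thesis by (simp add: qpoch_Suc fps_inverse_mult mult.assoc[symmetric])
  qed
  moreover have "j - 1 = int n" "nat j = Suc n" by (auto simp: j)
  ultimately show ?thesis by (simp only: j inv_qpoch_nat)
qed (simp add: inv_qpoch_neg)

lemma filterlim_int_add: "filterlim (\<lambda>L. int L + c) at_top sequentially"
  unfolding filterlim_at_top
proof
  fix Z
  show "eventually (\<lambda>L. Z \<le> int L + c) sequentially"
    by (rule eventually_sequentiallyI[of "nat (Z - c)"]) simp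
qed

lemma tendsto_inv_qpoch:
  assumes "d > 0" and f: "filterlim f at_top net"
  shows "((\<lambda>x. inv_qpoch (fps_X ^ d) (f x)) \<longlongrightarrow> inverse (euler_prod {i. 0 < i \<and> d dvd i})) net"
proof -
  have "(\<lambda>n. qpoch (fps_X ^ d) n) \<longlonglongrightarrow> euler_prod {i. 0 < i \<and> d dvd i}"
  proof -
    have "qpoch (fps_X ^ d) n = (\<Prod>i\<in>(\<lambda>i. d * i) ` {1..n}. 1 - fps_X ^ i)" for n
      unfolding qpoch_def using assms(1)
      by (subst prod.reindex) (auto simp: inj_on_def power_mult)
    moreover have "(\<lambda>n. \<Prod>i\<in>(\<lambda>i. d * i) ` {1..n}. 1 - fps_X ^ i) \<longlonglongrightarrow> euler_prod {i. 0 < i \<and> d dvd i}"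
    proof (rule tendsto_euler_prod)
      fix i assume i: "i \<in> {i. 0 < i \<and> d dvd i}"
      then obtain c where c: "i = d * c" "c > 0" by (auto elim!: dvdE)
      show "eventually (\<lambda>n. i \<in> (\<lambda>i. d * i) ` {1..n}) sequentially"
        by (rule eventually_sequentiallyI[of c]) (use c in auto)
    qed (use assms(1) in auto)
    ultimately show ?thesis by simp
  qed
  then have "(\<lambda>n. inverse (qpoch (fps_X ^ d) n)) \<longlonglongrightarrow> inverse (euler_prod {i. 0 < i \<and> d dvd i})"
    by (rule tendsto_inverse_fps) simp
  moreover have "filterlim (\<lambda>x. nat (f x)) sequentially net"
    by (rule filterlim_compose[OF _ f]) (rule filterlim_nat_sequentially)
  ultimately have "((\<lambda>x. inverse (qpoch (fps_X ^ d) (nat (f x)))) \<longlongrightarrow> inverse (euler_prod {i. 0 < i \<and> d dvd i})) net"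
    by (rule filterlim_compose)
  moreover have "eventually (\<lambda>x. inv_qpoch (fps_X ^ d) (f x) = inverse (qpoch (fps_X ^ d) (nat (f x)))) net"
    using filterlim_at_top[THEN iffD1, OF f, rule_format, of 0] by eventually_elim (simp add: inv_qpoch_def)
  ultimately show ?thesis by (simp add: tendsto_cong)
qed

text \<open>Triangular numbers, with an integer argument so that the exponents of two-sided theta series
  are natural numbers.\<close>

definition tri :: "int \<Rightarrow> nat" where
  "tri k = nat (k * (k + 1) div 2)"

lemma int_tri: "2 * int (tri k) = k * (k + 1)"
proof -
  have "k * (k + 1) \<ge> 0" by (cases "k \<ge> 0") (auto simp: mult_nonpos_nonpos)
  moreover have "even (k * (k + 1))" by simp
  ultimately show ?thesis unfolding tri_def by simp
qed

lemma tri_pred: "int (tri (k - 1)) = int (tri k) - k"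
  using int_tri[of k] int_tri[of "k - 1"] by (simp add: algebra_simps)

lemma tri_neg: "int (tri (- k)) = int (tri k) - k"
  using int_tri[of k] int_tri[of "- k"] by (simp add: algebra_simps)

text \<open>The general term of Ramanujan's theta function \<open>f(-a, -b)\<close>. The symmetric parametrisation by
  \<open>a\<close> and \<open>b\<close>, with base \<open>q = a b\<close>, needs no negative powers and covers both monomials
  \<open>a = q^\<alpha>\<close> and constants such as roots of unity.\<close>

definition theta_coeff :: "complex fps \<Rightarrow> complex fps \<Rightarrow> int \<Rightarrow> complex fps" where
  "theta_coeff a b k = (-1) ^ nat \<bar>k\<bar> * a ^ tri k * b ^ tri (- k)"

lemma minus_one_power_abs_pred: "(-1 :: 'a::ring_1) ^ nat \<bar>k - 1\<bar> = - ((-1) ^ nat \<bar>k\<bar>)" for k :: int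
proof -
  have "even (nat \<bar>k - 1\<bar>) \<longleftrightarrow> \<not> even (nat \<bar>k\<bar>)"
    by (simp add: even_nat_iff)
  then show ?thesis by (simp add: minus_one_power_iff)
qed

text \<open>The quotient of consecutive theta terms, multiplied out so that only natural exponents occur.\<close>

lemma theta_coeff_pred:
  assumes "k \<le> int m + 1"
  shows "a * (a * b) ^ m * theta_coeff a b (k - 1) = - ((a * b) ^ nat (int m + 1 - k) * theta_coeff a b k)"
proof -
  have 1: "1 + m + tri (k - 1) = nat (int m + 1 - k) + tri k"
    using assms tri_pred[of k] by linarith
  have 2: "m + tri (- (k - 1)) = nat (int m + 1 - k) + tri (- k)"
    using assms tri_pred[of k] tri_neg[of k] tri_neg[of "k - 1"] by linarith
  have "a * (a * b) ^ m * theta_coeff a b (k - 1)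
      = - ((-1) ^ nat \<bar>k\<bar>) * a ^ (1 + m + tri (k - 1)) * b ^ (m + tri (- (k - 1)))"
    unfolding theta_coeff_def minus_one_power_abs_pred
    by (simp add: power_add power_mult_distrib mult_ac)
  then show ?thesis
    unfolding 1 2 theta_coeff_def by (simp add: power_add power_mult_distrib mult_ac)
qed

lemma theta_coeff_uminus: "theta_coeff a b (- k) = theta_coeff b a k"
  by (simp add: theta_coeff_def mult_ac)

text \<open>Multiplication by the factor \<open>1 - a q^m\<close> takes the right-hand side of the finite triple product
  for \<open>(m, n)\<close> to the one for \<open>(m + 1, n)\<close>. Over the common term with index \<open>k\<close>, the two
  contributions are \<open>1 - q^(m+1-k)\<close> and, after shifting the index, \<open>q^(m+1-k) (1 - q^(n+k))\<close>; they
  add up to \<open>1 - q^(m+n+1)\<close>, as in Pascal's rule for Gaussian binomials.\<close>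

lemma finite_triple_product_step:
  fixes a b :: "complex fps"
  defines "q \<equiv> a * b"
  assumes q0: "(a * b) $ 0 = 0"
  defines "T \<equiv> \<lambda>m n. qpoch q (m + n) *
     (\<Sum>k\<in>{- int n..int m}. theta_coeff a b k * inv_qpoch q (int m - k) * inv_qpoch q (int n + k))"
  shows "(1 - a * q ^ m) * T m n = T (Suc m) n"
proof -
  note st = inv_qpoch_step[OF q0, folded q_def]
  let ?c = "theta_coeff a b"
  let ?R = "inv_qpoch q"
  let ?f = "\<lambda>k. ?c k * ?R (int m + 1 - k) * ?R (int n + k)"
  let ?I = "{- int n..int m + 1}"
  have A: "(\<Sum>k\<in>{- int n..int m}. ?c k * ?R (int m - k) * ?R (int n + k))
      = (\<Sum>k\<in>?I. (1 - q ^ nat (int m + 1 - k)) * ?f k)"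
  proof -
    have "(\<Sum>k\<in>{- int n..int m}. ?c k * ?R (int m - k) * ?R (int n + k))
        = (\<Sum>k\<in>?I. ?c k * ?R (int m - k) * ?R (int n + k))"
      by (rule sum.mono_neutral_left) (auto simp: inv_qpoch_neg)
    also have "\<dots> = (\<Sum>k\<in>?I. (1 - q ^ nat (int m + 1 - k)) * ?f k)"
    proof (rule sum.cong)
      fix k assume "k \<in> ?I"
      then have "?R (int m - k) = (1 - q ^ nat (int m + 1 - k)) * ?R (int m + 1 - k)"
        using st[of "int m + 1 - k"] by (simp add: algebra_simps)
      then show "?c k * ?R (int m - k) * ?R (int n + k) = (1 - q ^ nat (int m + 1 - k)) * ?f k"
        by (simp add: mult_ac)
    qed simp
    finally show ?thesis .
  qed
  \<comment> \<open>The index is shifted so that the theta term and the reciprocals match those of the goal.\<close>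
  have B: "a * q ^ m * (\<Sum>k\<in>{- int n..int m}. ?c k * ?R (int m - k) * ?R (int n + k))
      = (\<Sum>k\<in>?I. - (q ^ nat (int m + 1 - k) * (1 - q ^ nat (int n + k))) * ?f k)"
  proof -
    have "a * q ^ m * (\<Sum>k\<in>{- int n..int m}. ?c k * ?R (int m - k) * ?R (int n + k))
        = (\<Sum>k\<in>{- int n..int m}. a * q ^ m * ?c k * ?R (int m - k) * ?R (int n + k))"
      by (simp add: sum_distrib_left mult_ac)
    also have "\<dots> = (\<Sum>k\<in>{- int n + 1..int m + 1}. a * q ^ m * ?c (k - 1) * ?R (int m + 1 - k) * ?R (int n + k - 1))"
      by (rule sum.reindex_bij_witness[of _ "\<lambda>k. k - 1" "\<lambda>k. k + 1"]) (auto simp: algebra_simps)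
    also have "\<dots> = (\<Sum>k\<in>?I. a * q ^ m * ?c (k - 1) * ?R (int m + 1 - k) * ?R (int n + k - 1))"
    proof (rule sum.mono_neutral_left)
      show "\<forall>k\<in>?I - {- int n + 1..int m + 1}. a * q ^ m * ?c (k - 1) * ?R (int m + 1 - k) * ?R (int n + k - 1) = 0"
        by (auto simp: inv_qpoch_neg)
    qed auto
    also have "\<dots> = (\<Sum>k\<in>?I. - (q ^ nat (int m + 1 - k) * (1 - q ^ nat (int n + k))) * ?f k)"
    proof (rule sum.cong)
      fix k assume k: "k \<in> ?I"
      then have "?R (int n + k - 1) = (1 - q ^ nat (int n + k)) * ?R (int n + k)"
        by (intro st) auto
      moreover have "a * q ^ m * ?c (k - 1) = - (q ^ nat (int m + 1 - k) * ?c k)"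
        using k unfolding q_def by (intro theta_coeff_pred) auto
      ultimately show "a * q ^ m * ?c (k - 1) * ?R (int m + 1 - k) * ?R (int n + k - 1)
          = - (q ^ nat (int m + 1 - k) * (1 - q ^ nat (int n + k))) * ?f k"
        by (simp add: mult_ac)
    qed simp
    finally show ?thesis .
  qed
  have "(1 - a * q ^ m) * (\<Sum>k\<in>{- int n..int m}. ?c k * ?R (int m - k) * ?R (int n + k))
      = (\<Sum>k\<in>?I. (1 - q ^ Suc (m + n)) * ?f k)"
  proof -
    have "(1 - q ^ nat (int m + 1 - k)) * ?f k - (- (q ^ nat (int m + 1 - k) * (1 - q ^ nat (int n + k))) * ?f k)
        = (1 - q ^ Suc (m + n)) * ?f k" if "k \<in> ?I" for k
    proof -
      have "Suc (m + n) = nat (int m + 1 - k) + nat (int n + k)" using that by auto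
      then have "q ^ Suc (m + n) = q ^ nat (int m + 1 - k) * q ^ nat (int n + k)" by (simp only: power_add)
      then show ?thesis by (simp only:) (simp add: algebra_simps)
    qed
    then show ?thesis
      unfolding left_diff_distrib[of 1 "a * q ^ m"] mult_1_left B
      unfolding A sum_subtractf[symmetric] by (rule sum.cong[OF refl])
  qed
  also have "\<dots> = (1 - q ^ Suc (m + n)) * (\<Sum>k\<in>?I. ?f k)"
    by (rule sum_distrib_left[symmetric])
  finally have *: "(1 - a * q ^ m) * (\<Sum>k\<in>{- int n..int m}. ?c k * ?R (int m - k) * ?R (int n + k))
      = (1 - q ^ Suc (m + n)) * (\<Sum>k\<in>?I. ?f k)" .
  have "(1 - a * q ^ m) * T m n = qpoch q (m + n) *
      ((1 - a * q ^ m) * (\<Sum>k\<in>{- int n..int m}. ?c k * ?R (int m - k) * ?R (int n + k)))"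
    unfolding T_def by (rule mult.left_commute)
  also have "\<dots> = qpoch q (Suc m + n) * (\<Sum>k\<in>?I. ?f k)"
    unfolding * by (simp add: qpoch_Suc)
  also have "\<dots> = T (Suc m) n"
    unfolding T_def by (simp add: add.commute)
  finally show ?thesis .
qed

text \<open>Both sides are symmetric under exchanging \<open>(a, m)\<close> with \<open>(b, n)\<close> and replacing \<open>k\<close> by \<open>-k\<close>, so
  the step in \<open>m\<close> also yields the step in \<open>n\<close>, and everything reduces to the trivial case
  \<open>m = n = 0\<close>.\<close>

lemma finite_triple_product:
  fixes a b :: "complex fps"
  defines "q \<equiv> a * b"
  assumes q0: "(a * b) $ 0 = 0"
  shows "(\<Prod>j<m. 1 - a * q ^ j) * (\<Prod>j<n. 1 - b * q ^ j) = qpoch q (m + n) *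
     (\<Sum>k\<in>{- int n..int m}. theta_coeff a b k * inv_qpoch q (int m - k) * inv_qpoch q (int n + k))"
proof -
  define T where "T a b m n = qpoch (a * b) (m + n) *
     (\<Sum>k\<in>{- int n..int m}. theta_coeff a b k * inv_qpoch (a * b) (int m - k) * inv_qpoch (a * b) (int n + k))"
    for a b m n
  have step: "(1 - a * (a * b) ^ m) * T a b m n = T a b (Suc m) n" if "(a * b) $ 0 = 0" for a b m n
    unfolding T_def by (rule finite_triple_product_step[OF that])
  have sym: "T a b m n = T b a n m" for a b m n
    unfolding T_def mult.commute[of a b] add.commute[of m n]
    by (rule arg_cong[where f = "\<lambda>x. _ * x"], rule sum.reindex_bij_witness[of _ uminus uminus])
       (auto simp: theta_coeff_uminus mult_ac)
  have T00: "T a b 0 0 = 1"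
    by (simp add: T_def qpoch_def theta_coeff_def tri_def)
  have n: "(\<Prod>j<n. 1 - b * q ^ j) = T a b 0 n"
  proof (induction n)
    case (Suc n)
    have "(\<Prod>j<Suc n. 1 - b * q ^ j) = (1 - b * (b * a) ^ n) * T b a n 0"
      using Suc by (simp add: sym[of a] q_def mult_ac)
    also have "\<dots> = T b a (Suc n) 0" using q0 by (intro step) (simp add: mult.commute)
    finally show ?case by (simp add: sym[of a])
  qed (simp add: T00)
  have "(\<Prod>j<m. 1 - a * q ^ j) * T a b 0 n = T a b m n"
  proof (induction m)
    case (Suc m)
    have "(\<Prod>j<Suc m. 1 - a * q ^ j) * T a b 0 n = (1 - a * q ^ m) * ((\<Prod>j<m. 1 - a * q ^ j) * T a b 0 n)"
      by (simp add: mult_ac)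
    also have "\<dots> = T a b (Suc m) n"
      unfolding Suc unfolding q_def by (rule step[OF q0])
    finally show ?case .
  qed simp
  also have "T a b m n = qpoch q (m + n) *
     (\<Sum>k\<in>{- int n..int m}. theta_coeff a b k * inv_qpoch q (int m - k) * inv_qpoch q (int n + k))"
    by (simp only: T_def q_def)
  finally show ?thesis unfolding n .
qed

text \<open>A case of the \<open>q\<close>-Vandermonde identity. In the limit \<open>m \<rightarrow> \<infinity>\<close> it classifies the partitions by
  their Durfee rectangle of size \<open>j\<close> by \<open>j + r\<close>. Writing
  \<open>1 - q^m = (1 - q^(m-j)) + q^(m-j) (1 - q^j)\<close> expresses the sum for \<open>(m, r)\<close> by those for
  \<open>(m - 1, r)\<close> and \<open>(m - 1, r + 1)\<close>, which is why \<open>r\<close> has to vary in the induction.\<close>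

lemma durfee_rectangle_sum:
  assumes q0: "q $ 0 = 0"
  shows "(\<Sum>j\<le>m. q ^ (j * (j + r)) * inv_qpoch q (int m - int j) * inv_qpoch q (int j) * inv_qpoch q (int j + int r))
     = inv_qpoch q (int m) * inv_qpoch q (int m + int r)"
proof (induction m arbitrary: r)
  case (Suc m)
  note st = inv_qpoch_step[OF q0]
  let ?R = "inv_qpoch q"
  let ?F = "\<lambda>m r. \<Sum>j\<le>m. q ^ (j * (j + r)) * ?R (int m - int j) * ?R (int j) * ?R (int j + int r)"
  let ?M = "Suc m"
  have "(1 - q ^ ?M) * ?F ?M r
     = (\<Sum>j\<le>?M. q ^ (j * (j + r)) * ?R (int m - int j) * ?R (int j) * ?R (int j + int r)
          + q ^ (?M - j + j * (j + r)) * ?R (int ?M - int j) * ?R (int j - 1) * ?R (int j + int r))"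
    unfolding sum_distrib_left
  proof (rule sum.cong)
    fix j assume "j \<in> {..?M}"
    then have j: "j \<le> ?M" by simp
    have n: "nat (int ?M - int j) = ?M - j" by simp
    have 1: "?R (int m - int j) = (1 - q ^ (?M - j)) * ?R (int ?M - int j)"
      using st[of "int ?M - int j"] j unfolding n by (simp add: algebra_simps)
    have 2: "?R (int j - 1) = (1 - q ^ j) * ?R (int j)"
      using st[of "int j"] by simp
    have 3: "q ^ ?M = q ^ (?M - j) * q ^ j"
      using j by (metis le_add_diff_inverse2 power_add)
    show "(1 - q ^ ?M) * (q ^ (j * (j + r)) * ?R (int ?M - int j) * ?R (int j) * ?R (int j + int r))
      = q ^ (j * (j + r)) * ?R (int m - int j) * ?R (int j) * ?R (int j + int r)
          + q ^ (?M - j + j * (j + r)) * ?R (int ?M - int j) * ?R (int j - 1) * ?R (int j + int r)"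
      unfolding 1 2 3 power_add[of q "?M - j"] by algebra
  qed simp
  also have "\<dots> = (\<Sum>j\<le>?M. q ^ (j * (j + r)) * ?R (int m - int j) * ?R (int j) * ?R (int j + int r))
      + (\<Sum>j\<le>?M. q ^ (?M - j + j * (j + r)) * ?R (int ?M - int j) * ?R (int j - 1) * ?R (int j + int r))"
    by (rule sum.distrib)
  also have "(\<Sum>j\<le>?M. q ^ (j * (j + r)) * ?R (int m - int j) * ?R (int j) * ?R (int j + int r)) = ?F m r"
    by (simp add: inv_qpoch_neg)
  also have "(\<Sum>j\<le>?M. q ^ (?M - j + j * (j + r)) * ?R (int ?M - int j) * ?R (int j - 1) * ?R (int j + int r))
      = q ^ (?M + r) * ?F m (Suc r)"
    unfolding sum.atMost_Suc_shift sum_distrib_left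
  proof -
    have "q ^ (?M - Suc j + Suc j * (Suc j + r)) = q ^ (?M + r) * q ^ (j * (j + Suc r))" if "j \<le> m" for j
      using that unfolding power_add[symmetric] by (intro arg_cong[of _ _ "(^) q"]) (simp add: algebra_simps)
    then have "(\<Sum>j\<le>m. q ^ (?M - Suc j + Suc j * (Suc j + r)) * ?R (int m - int j) * ?R (int j) * ?R (int j + int (Suc r)))
     = (\<Sum>j\<le>m. q ^ (?M + r) * (q ^ (j * (j + Suc r)) * ?R (int m - int j) * ?R (int j) * ?R (int j + int (Suc r))))"
      by (intro sum.cong refl) (simp only: mult.assoc atMost_iff)
    moreover have "int ?M - int (Suc j) = int m - int j" "int (Suc j) - 1 = int j"
      "int (Suc j) + int r = int j + int (Suc r)" for j by simp_all
    ultimately show "q ^ (?M - 0 + 0 * (0 + r)) * ?R (int ?M - int 0) * ?R (int 0 - 1) * ?R (int 0 + int r) +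
      (\<Sum>j\<le>m. q ^ (?M - Suc j + Suc j * (Suc j + r)) * ?R (int ?M - int (Suc j)) * ?R (int (Suc j) - 1) * ?R (int (Suc j) + int r))
     = (\<Sum>j\<le>m. q ^ (?M + r) * (q ^ (j * (j + Suc r)) * ?R (int m - int j) * ?R (int j) * ?R (int j + int (Suc r))))"
      by (simp only: inv_qpoch_neg[of "int 0 - 1"]) simp
  qed
  also have "?F m r + q ^ (?M + r) * ?F m (Suc r)
      = ?R (int m) * (?R (int m + int r) + q ^ (?M + r) * ?R (int m + int (Suc r)))"
    unfolding Suc by (simp add: algebra_simps)
  also have "?R (int m + int r) = (1 - q ^ (?M + r)) * ?R (int m + int (Suc r))"
    using st[of "int m + int (Suc r)"] by (simp add: nat_add_distrib add_ac)
  also have "?R (int m) = (1 - q ^ ?M) * ?R (int ?M)"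
    using st[of "int ?M"] by (simp add: nat_add_distrib)
  finally have "(1 - q ^ ?M) * ?F ?M r = (1 - q ^ ?M) * (?R (int ?M) * ?R (int ?M + int r))"
    by (simp add: algebra_simps)
  moreover have "(1 - q ^ ?M) $ 0 \<noteq> 0" using q0 by (simp add: fps_nth_power_0)
  then have "1 - q ^ ?M \<noteq> 0" by (metis fps_zero_nth)
  ultimately show ?case by simp
qed simp

section \<open>The Jacobi triple product and a quintuple product modulo 18\<close>

definition theta_exp :: "nat \<Rightarrow> nat \<Rightarrow> int \<Rightarrow> nat" where
  "theta_exp a b k = a * tri k + b * tri (- k)"

lemma int_theta_exp: "2 * int (theta_exp a b k) = int a * (k * (k + 1)) + int b * (k * (k - 1))"
proof -
  have "2 * int (theta_exp a b k) = int a * (2 * int (tri k)) + int b * (2 * int (tri (- k)))"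
    by (simp add: theta_exp_def algebra_simps)
  then show ?thesis unfolding int_tri by (simp add: algebra_simps)
qed

definition alt_sign :: "int \<Rightarrow> complex" where
  "alt_sign k = (if even k then 1 else - 1)"

lemma fin_fibers_theta_exp:
  assumes "a > 0" "b > 0"
  shows "fin_fibers (theta_exp a b) A"
proof (rule fin_fibers_abs_le[of _ _ 0])
  fix k
  have "nat \<bar>k\<bar> \<le> tri k + tri (- k)"
    proof -
    have "k * k = \<bar>k\<bar> * \<bar>k\<bar>" by simp
    moreover have "\<bar>k\<bar> * 1 \<le> \<bar>k\<bar> * \<bar>k\<bar>"
    proof (cases "k = 0")
      case False
      then show ?thesis by (intro mult_left_mono) auto
    qed simp
    moreover have "int (tri k) + int (tri (- k)) = k * k"
      using tri_neg[of k] int_tri[of k] by (simp add: algebra_simps)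
    ultimately show ?thesis by linarith
  qed
  also have "\<dots> \<le> theta_exp a b k"
    unfolding theta_exp_def using assms by (intro add_mono) simp_all
  finally show "nat \<bar>k\<bar> \<le> theta_exp a b k + 0" by simp
qed

text \<open>The limit of the finite triple product for the monomials \<open>X^a\<close> and \<open>X^b\<close>, with the product side
  read as an Euler product. The hypothesis \<open>a \<noteq> b\<close> keeps the two residue classes of exponents distinct, so
  that the product runs over a set.\<close>

lemma jacobi_triple_product:
  assumes ab: "0 < a" "0 < b" "a \<noteq> b"
  shows "euler_prod {i. 0 < i \<and> (i mod (a + b) = 0 \<or> i mod (a + b) = a \<or> i mod (a + b) = b)}
     = gf (theta_exp a b) alt_sign UNIV"
proof -
  let ?d = "a + b"
  let ?D = "{i. 0 < i \<and> ?d dvd i}" and ?S = "{i. i mod ?d = a \<or> i mod ?d = b}"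
  let ?R = "inv_qpoch (fps_X ^ ?d)" and ?E = "inverse (euler_prod ?D)"
  have X: "(fps_X ^ a * fps_X ^ b :: complex fps) = fps_X ^ ?d" by (simp add: power_add)
  have X0: "(fps_X ^ a * fps_X ^ b :: complex fps) $ 0 = 0" using ab by (simp add: fps_X_power_nth X)
  have coeff: "theta_coeff (fps_X ^ a) (fps_X ^ b) k = fps_X ^ theta_exp a b k * fps_const (alt_sign k)" for k
  proof -
    have "fps_const (alt_sign k) = (-1) ^ nat \<bar>k\<bar>"
      by (simp add: alt_sign_def minus_one_power_iff even_nat_iff fps_const_neg[symmetric] del: fps_const_neg)
    then show ?thesis
      by (simp add: theta_coeff_def theta_exp_def power_add power_mult mult_ac)
  qed
  define F where "F N = (\<lambda>j. a + ?d * j) ` {..<N} \<union> (\<lambda>j. b + ?d * j) ` {..<N}" for N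
  have F_mod: "(a + ?d * j) mod ?d = a" "(b + ?d * j) mod ?d = b" for j
    using ab by simp_all
  have fin: "(\<Prod>i\<in>F N. 1 - fps_X ^ i) = qpoch (fps_X ^ ?d) (N + N) *
     (\<Sum>k\<in>{- int N..int N}. fps_X ^ theta_exp a b k * (fps_const (alt_sign k) * (?R (int N - k) * ?R (int N + k))))" for N
  proof -
    have inj: "inj_on (\<lambda>j. c + ?d * j) {..<N}" for c using ab by (auto simp: inj_on_def)
    have "(\<lambda>j. a + ?d * j) ` {..<N} \<inter> (\<lambda>j. b + ?d * j) ` {..<N} = {}"
    proof (rule ccontr)
      assume "(\<lambda>j. a + ?d * j) ` {..<N} \<inter> (\<lambda>j. b + ?d * j) ` {..<N} \<noteq> {}"
      then obtain i j where "a + ?d * i = b + ?d * j" by auto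
      then show False using F_mod ab(3) by metis
    qed
    then have "(\<Prod>i\<in>F N. 1 - fps_X ^ i :: complex fps)
       = (\<Prod>j<N. 1 - fps_X ^ (a + ?d * j)) * (\<Prod>j<N. 1 - fps_X ^ (b + ?d * j))"
      unfolding F_def by (subst prod.union_disjoint) (simp_all add: prod.reindex[OF inj])
    also have "\<dots> = (\<Prod>j<N. 1 - fps_X ^ a * (fps_X ^ a * fps_X ^ b) ^ j) * (\<Prod>j<N. 1 - fps_X ^ b * (fps_X ^ a * fps_X ^ b) ^ j)"
      unfolding X by (simp only: power_add power_mult)
    also have "\<dots> = qpoch (fps_X ^ ?d) (N + N) *
      (\<Sum>k\<in>{- int N..int N}. fps_X ^ theta_exp a b k * (fps_const (alt_sign k) * (?R (int N - k) * ?R (int N + k))))"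
      unfolding finite_triple_product[OF X0] coeff unfolding X by (simp only: mult.assoc)
    finally show ?thesis .
  qed
  have R: "(\<lambda>L. ?R (int L + c)) \<longlonglongrightarrow> ?E" for c
    by (rule tendsto_inv_qpoch[OF _ filterlim_int_add]) (use ab in simp)
  have E1: "euler_prod ?D * ?E = 1" by (rule inverse_mult_eq_1') simp
  have ff: "fin_fibers (theta_exp a b) UNIV" by (rule fin_fibers_theta_exp) fact+
  have "(\<lambda>N. \<Sum>k\<in>{- int N..int N}. fps_X ^ theta_exp a b k * (fps_const (alt_sign k) * (?R (int N - k) * ?R (int N + k))))
     \<longlonglongrightarrow> gf (theta_exp a b) alt_sign UNIV * (?E * ?E)"
  proof (rule tannery_fps[OF ff])
    show "(\<lambda>N. fps_const (alt_sign k) * (?R (int N - k) * ?R (int N + k))) \<longlonglongrightarrow> fps_const (alt_sign k) * (?E * ?E)" for k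
      using R[of "- k"] R[of k] by (intro tendsto_mult_fps tendsto_const) simp_all
    have "(\<lambda>N. \<Sum>k\<in>{- int N..int N}. fps_X ^ theta_exp a b k * fps_const (alt_sign k)) \<longlonglongrightarrow> gf (theta_exp a b) alt_sign UNIV"
    proof (rule tendsto_gf[OF ff])
      fix k :: int
      show "eventually (\<lambda>N. k \<in> {- int N..int N}) sequentially"
        by (intro eventually_sequentiallyI[of "nat \<bar>k\<bar>"]) auto
    qed auto
    from tendsto_mult_fps[OF this tendsto_const]
    show "(\<lambda>N. \<Sum>k\<in>{- int N..int N}. fps_X ^ theta_exp a b k * (fps_const (alt_sign k) * (?E * ?E)))
      \<longlonglongrightarrow> gf (theta_exp a b) alt_sign UNIV * (?E * ?E)"
      by (simp only: sum_distrib_right mult.assoc)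
  qed auto
  moreover have "(\<lambda>N. qpoch (fps_X ^ ?d) (N + N)) \<longlonglongrightarrow> euler_prod ?D"
  proof -
    have "filterlim (\<lambda>N. int (N + N)) at_top sequentially"
      unfolding filterlim_at_top
    proof
      fix Z
      show "eventually (\<lambda>L. Z \<le> int (L + L)) sequentially"
        by (rule eventually_sequentiallyI[of "nat Z"]) simp
    qed
    from tendsto_inv_qpoch[OF _ this, of ?d]
    have "(\<lambda>N. inverse (qpoch (fps_X ^ ?d) (N + N))) \<longlonglongrightarrow> ?E"
      using ab unfolding inv_qpoch_nat by simp
    then have "(\<lambda>N. inverse (inverse (qpoch (fps_X ^ ?d) (N + N)))) \<longlonglongrightarrow> inverse ?E"
      by (rule tendsto_inverse_fps) simp
    moreover have "inverse (inverse f) = f" if "f $ 0 = 1" for f :: "complex fps"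
      using that by (intro fps_inverse_idempotent) simp
    ultimately show ?thesis using ab by (simp add: qpoch_nth_0)
  qed
  ultimately have "(\<lambda>N. \<Prod>i\<in>F N. 1 - fps_X ^ i) \<longlonglongrightarrow> euler_prod ?D * (gf (theta_exp a b) alt_sign UNIV * (?E * ?E))"
    unfolding fin by (rule tendsto_mult_fps[rotated])
  moreover have "(\<lambda>N. \<Prod>i\<in>F N. 1 - fps_X ^ i) \<longlonglongrightarrow> euler_prod ?S"
  proof (rule tendsto_euler_prod)
    show "F N \<subseteq> ?S" for N unfolding F_def Un_subset_iff image_subset_iff mem_Collect_eq F_mod by simp
    fix i assume "i \<in> ?S"
    then have "i mod ?d = a \<or> i mod ?d = b" by simp
    with mod_mult_div_eq[of i ?d] have "a + ?d * (i div ?d) = i \<or> b + ?d * (i div ?d) = i"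
      by (elim disjE) (simp_all only: simp_thms)
    moreover have "i div ?d < N" if "Suc i \<le> N" for N
      using that div_le_dividend[of i ?d] by linarith
    ultimately have "i \<in> F N" if "Suc i \<le> N" for N
      unfolding F_def Un_iff image_iff using that by (metis lessThan_iff)
    then show "eventually (\<lambda>N. i \<in> F N) sequentially"
      by (rule eventually_sequentiallyI)
  qed (use ab in \<open>auto simp: F_def\<close>)
  ultimately have "euler_prod ?S = euler_prod ?D * (gf (theta_exp a b) alt_sign UNIV * (?E * ?E))"
    by (rule LIMSEQ_unique[rotated])
  then have "euler_prod ?S * euler_prod ?D = gf (theta_exp a b) alt_sign UNIV * (euler_prod ?D * ?E) * (euler_prod ?D * ?E)"
    by (simp add: mult_ac)
  also have "euler_prod ?S * euler_prod ?D = euler_prod (?S \<union> ?D)"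
    using ab by (intro euler_prod_Un[symmetric]) auto
  also have "?S \<union> ?D = {i. 0 < i \<and> (i mod ?d = 0 \<or> i mod ?d = a \<or> i mod ?d = b)}"
    using ab by (auto simp: mod_eq_0_iff_dvd intro: gr0I)
  finally show ?thesis by (simp add: E1)
qed

text \<open>The nontrivial Dirichlet character modulo 3.\<close>

definition char3 :: "int \<Rightarrow> complex" where
  "char3 k = (if k mod 3 = 1 then 1 else if k mod 3 = 2 then - 1 else 0)"

text \<open>The exponents \<open>(3 k\<^sup>2 - k - 2) / 2\<close> of the theta series in the quintuple product. At \<open>k = 0\<close>
  the true exponent would be \<open>-1\<close>; that index is excluded throughout, in agreement with
  \<open>char3 0 = 0\<close>.\<close>

definition num_exp :: "int \<Rightarrow> nat" where
  "num_exp k = nat ((3 * k\<^sup>2 - k - 2) div 2)"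

lemma num_exp:
  assumes "k \<noteq> 0"
  shows "2 * int (num_exp k) = 3 * k\<^sup>2 - k - 2" and "num_exp k = (nat \<bar>k\<bar>)\<^sup>2 - 1 + tri (- k)"
    and "nat \<bar>k\<bar> \<le> num_exp k + 1"
proof -
  have "\<bar>k\<bar> * 1 \<le> \<bar>k\<bar> * \<bar>k\<bar>" using assms by (intro mult_left_mono) auto
  then have 1: "\<bar>k\<bar> \<le> k\<^sup>2" by (simp add: power2_eq_square)
  have e: "even (3 * k\<^sup>2 - k - 2)" by simp
  have "3 * k\<^sup>2 - k - 2 \<ge> 0" using 1 assms by linarith
  then have "int (num_exp k) = (3 * k\<^sup>2 - k - 2) div 2" unfolding num_exp_def by simp
  with e show *: "2 * int (num_exp k) = 3 * k\<^sup>2 - k - 2" by (metis even_two_times_div_two)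
  have "int ((nat \<bar>k\<bar>)\<^sup>2) = k\<^sup>2" by simp
  moreover have "2 * int (tri (- k)) = k\<^sup>2 - k" 
    using int_tri[of "- k"] by (simp add: power2_eq_square algebra_simps)
  ultimately show "num_exp k = (nat \<bar>k\<bar>)\<^sup>2 - 1 + tri (- k)"
    using * 1 assms by linarith
  show "nat \<bar>k\<bar> \<le> num_exp k + 1"
    using * 1 assms by linarith
qed

text \<open>The double sum on the left runs over pairs \<open>(m, n)\<close> with exponent
  \<open>(9 m\<^sup>2 - m) / 2 + 9 n\<^sup>2 + 8 n\<close> and is sorted by \<open>k = m + 2 n + 1\<close>. For fixed \<open>k\<close> the exponent is
  a quadratic polynomial in \<open>n\<close>. If \<open>3\<close> divides \<open>k\<close>, a reflection of \<open>n\<close> preserves it and changes the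
  sign. Otherwise a translation of \<open>n\<close> by the quotient of \<open>k\<close> by 3 (combined with a reflection if
  \<open>k\<close> leaves remainder 2) turns it into \<open>num_exp k + 27 n\<^sup>2 + 9 n\<close>, whose second part is the
  exponent in the pentagonal number series in \<open>q\<^sup>1\<^sup>8\<close>.\<close>

lemma quintuple_theta:
  "gf (theta_exp 4 5) alt_sign UNIV * gf (theta_exp 17 1) alt_sign UNIV
   = gf num_exp char3 (UNIV - {0}) * gf (theta_exp 36 18) alt_sign UNIV"
proof -
  define w where "w = (\<lambda>(m, n). theta_exp 4 5 m + theta_exp 17 1 n)"
  define s where "s = (\<lambda>(m, n). alt_sign m * alt_sign n)"
  define v where "v = (\<lambda>(k, n). num_exp k + theta_exp 36 18 n)"
  define t where "t = (\<lambda>(k, n). char3 k * alt_sign n)"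
  define A where "A r = {(m :: int, n :: int). (m + 2 * n + 1) mod 3 = r}" for r
  define K where "K r = {k :: int. k \<noteq> 0 \<and> k mod 3 = r}" for r
  have ffw: "fin_fibers w B" for B
    unfolding w_def by (rule fin_fibers_subset[OF fin_fibers_Times[of _ UNIV _ UNIV]]) (auto intro!: fin_fibers_theta_exp)
  have ffn: "fin_fibers num_exp B" if "0 \<notin> B" for B
    by (rule fin_fibers_abs_le[of _ _ 1], rule num_exp(3)) (use that in auto)
  have w2: "2 * int (w (m, n)) = 9 * m\<^sup>2 - m + 18 * n\<^sup>2 + 16 * n" for m n
    using int_theta_exp[of 4 5 m] int_theta_exp[of 17 1 n] by (simp add: w_def power2_eq_square algebra_simps)
  have v2: "2 * int (v (k, n)) = 3 * k\<^sup>2 - k - 2 + 54 * n\<^sup>2 + 18 * n" if "k \<noteq> 0" for k n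
    using int_theta_exp[of 36 18 n] num_exp(1)[OF that] by (simp add: v_def power2_eq_square algebra_simps)
  have Kform: "k = 3 * (k div 3) + r" if "k \<in> K r" for k r
    using that by (auto simp: K_def)
  have Knz: "k \<noteq> 0" if "k \<in> K r" for k r
    using that by (auto simp: K_def)
  have Aform: "m = 3 * ((m + 2 * n + 1) div 3) + r - 2 * n - 1" if "(m, n) \<in> A r" for m n r
  proof -
    have "(m + 2 * n + 1) mod 3 = r" using that by (simp add: A_def)
    then show ?thesis using mult_div_mod_eq[of 3 "m + 2 * n + 1"] by linarith
  qed
  have 0: "gf w s (A 0) = 0"
  proof (rule gf_sign_reversing)
    \<comment> \<open>For \<open>m + 2 n = 3 t + 2\<close> the exponent is symmetric under \<open>n \<mapsto> 2 t + 1 - n\<close> with \<open>m + 2 n\<close> fixed.\<close>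
    define f where "f = (\<lambda>(m :: int, n). let t = (m + 2 * n + 1) div 3 - 1 in (m + 4 * n - 4 * t - 2, 2 * t + 1 - n))"
    have inv: "f (f p) = p \<and> f p \<in> A 0" if "p \<in> A 0" for p
    proof -
      obtain m n where p: "p = (m, n)" by (cases p)
      define t where "t = (m + 2 * n + 1) div 3 - 1"
      have m: "m = 3 * t + 2 - 2 * n" using Aform[of m n 0] that by (simp add: p t_def)
      have fp: "f p = (m + 4 * n - 4 * t - 2, 2 * t + 1 - n)" by (simp add: p f_def t_def Let_def)
      have "((m + 4 * n - 4 * t - 2) + 2 * (2 * t + 1 - n) + 1) = 3 * (t + 1)" using m by simp
      then show ?thesis unfolding fp unfolding f_def A_def Let_def p by (simp add: m)
    qed
    show "bij_betw f (A 0) (A 0)"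
      by (rule bij_betwI[of _ _ _ f]) (use inv in auto)
    fix p assume p: "p \<in> A 0"
    obtain m n where mn: "p = (m, n)" by (cases p)
    define t where "t = (m + 2 * n + 1) div 3 - 1"
    have m: "m = 3 * t + 2 - 2 * n" using Aform[of m n 0] p by (simp add: mn t_def)
    have fp: "f p = (m + 4 * n - 4 * t - 2, 2 * t + 1 - n)" by (simp add: mn f_def t_def Let_def)
    have "2 * int (w (f p)) = 2 * int (w p)"
      unfolding fp unfolding mn w2 m by algebra
    then show "w (f p) = w p" by simp
    show "s (f p) = - s p"
      unfolding fp unfolding mn s_def m by (simp add: alt_sign_def)
  qed
  have 1: "gf v t (K 1 \<times> UNIV) = gf w s (A 1)"
  proof (rule gf_reindex)
    show "bij_betw (\<lambda>(k, n). (k - 1 - 2 * n - 2 * (k div 3), n + k div 3)) (K 1 \<times> UNIV) (A 1)"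
      by (rule bij_betwI[of _ _ _ "\<lambda>(m, n). (m + 2 * n + 1, n - (m + 2 * n + 1) div 3)"]) (auto simp: K_def A_def)
    fix p assume p: "p \<in> K 1 \<times> (UNIV :: int set)"
    obtain k n where kn: "p = (k, n)" by (cases p)
    define u where "u = k div 3"
    have k: "k = 3 * u + 1" using p Kform[of k 1] by (simp add: kn u_def)
    have "2 * int (v p) = 2 * int (w (k - 1 - 2 * n - 2 * u, n + u))"
      using p unfolding kn w2 by (subst v2) (auto simp: K_def k power2_eq_square algebra_simps)
    then show "v p = w ((\<lambda>(k, n). (k - 1 - 2 * n - 2 * (k div 3), n + k div 3)) p)"
      by (simp add: kn u_def)
    have "t p = s (k - 1 - 2 * n - 2 * u, n + u)"
      unfolding kn t_def s_def k by (simp add: alt_sign_def char3_def)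
    then show "t p = s ((\<lambda>(k, n). (k - 1 - 2 * n - 2 * (k div 3), n + k div 3)) p)"
      by (simp add: kn u_def)
  qed
  have 2: "gf v t (K 2 \<times> UNIV) = gf w s (A 2)"
  proof (rule gf_reindex)
    show "bij_betw (\<lambda>(k, n). (k - 1 + 2 * n - 2 * (k div 3), k div 3 - n)) (K 2 \<times> UNIV) (A 2)"
      by (rule bij_betwI[of _ _ _ "\<lambda>(m, n). (m + 2 * n + 1, (m + 2 * n + 1) div 3 - n)"]) (auto simp: K_def A_def)
    fix p assume p: "p \<in> K 2 \<times> (UNIV :: int set)"
    obtain k n where kn: "p = (k, n)" by (cases p)
    define u where "u = k div 3"
    have k: "k = 3 * u + 2" using p Kform[of k 2] by (simp add: kn u_def)
    have "2 * int (v p) = 2 * int (w (k - 1 + 2 * n - 2 * u, u - n))"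
      using p unfolding kn w2 by (subst v2) (auto simp: K_def k power2_eq_square algebra_simps)
    then show "v p = w ((\<lambda>(k, n). (k - 1 + 2 * n - 2 * (k div 3), k div 3 - n)) p)"
      by (simp add: kn u_def)
    have "t p = s (k - 1 + 2 * n - 2 * u, u - n)"
      unfolding kn t_def s_def k by (simp add: alt_sign_def char3_def)
    then show "t p = s ((\<lambda>(k, n). (k - 1 + 2 * n - 2 * (k div 3), k div 3 - n)) p)"
      by (simp add: kn u_def)
  qed
  have "gf (theta_exp 4 5) alt_sign UNIV * gf (theta_exp 17 1) alt_sign UNIV = gf w s (UNIV \<times> UNIV)"
    unfolding w_def s_def by (rule gf_Times[symmetric]) (auto intro!: fin_fibers_theta_exp)
  also have "UNIV \<times> UNIV = A 0 \<union> (A 1 \<union> A 2)"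
    unfolding A_def by auto
  also have "gf w s (A 0 \<union> (A 1 \<union> A 2)) = gf w s (A 0) + (gf w s (A 1) + gf w s (A 2))"
  proof -
    have "A 0 \<inter> (A 1 \<union> A 2) = {}" "A 1 \<inter> A 2 = {}" by (auto simp: A_def)
    then show ?thesis by (simp add: gf_Un ffw)
  qed
  also have "\<dots> = gf num_exp char3 (K 1) * gf (theta_exp 36 18) alt_sign UNIV
      + gf num_exp char3 (K 2) * gf (theta_exp 36 18) alt_sign UNIV"
  proof -
    have "gf v t (K r \<times> UNIV) = gf num_exp char3 (K r) * gf (theta_exp 36 18) alt_sign UNIV" for r
      unfolding v_def t_def by (intro gf_Times ffn fin_fibers_theta_exp) (auto simp: K_def)
    then show ?thesis by (simp only: 0 1[symmetric] 2[symmetric] add_0_left)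
  qed
  also have "\<dots> = (gf num_exp char3 (K 0) + (gf num_exp char3 (K 1) + gf num_exp char3 (K 2))) * gf (theta_exp 36 18) alt_sign UNIV"
  proof -
    have "gf num_exp char3 (K 0) = 0" by (rule gf_zero) (simp add: K_def char3_def)
    then show ?thesis by (simp only: add_0_left distrib_right)
  qed
  also have "gf num_exp char3 (K 0) + (gf num_exp char3 (K 1) + gf num_exp char3 (K 2)) = gf num_exp char3 (K 0 \<union> (K 1 \<union> K 2))"
  proof -
    have "K 0 \<inter> (K 1 \<union> K 2) = {}" "K 1 \<inter> K 2 = {}" "0 \<notin> K r" for r by (auto simp: K_def)
    then show ?thesis by (simp add: gf_Un ffn)
  qed
  also have "K 0 \<union> (K 1 \<union> K 2) = UNIV - {0}"
  proof -
    have "k mod 3 = 0 \<or> k mod 3 = 1 \<or> k mod 3 = 2" for k :: int by presburger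
    then show ?thesis by (auto simp: K_def)
  qed
  finally show ?thesis .
qed

text \<open>The three theta series in \<open>quintuple_theta\<close> are triple products. The one with exponents
  \<open>36, 18\<close> is Euler's pentagonal number theorem, the product over the multiples of 18; it is also a
  factor of the one with exponents \<open>17, 1\<close> and cancels.\<close>

lemma quintuple_product_mod_18:
  "euler_prod ({i. 0 < i \<and> (i mod 9 = 0 \<or> i mod 9 = 4 \<or> i mod 9 = 5)} \<union> {i. i mod 18 = 17 \<or> i mod 18 = 1})
   = gf num_exp char3 (UNIV - {0})"
proof -
  let ?A = "{i :: nat. 0 < i \<and> (i mod 9 = 0 \<or> i mod 9 = 4 \<or> i mod 9 = 5)}"
  let ?B = "{i :: nat. i mod 18 = 17 \<or> i mod 18 = 1}"
  let ?C = "{i :: nat. 0 < i \<and> i mod 18 = 0}"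
  have A: "euler_prod ?A = gf (theta_exp 4 5) alt_sign UNIV"
    using jacobi_triple_product[of 4 5] by simp
  have B: "euler_prod (?B \<union> ?C) = gf (theta_exp 17 1) alt_sign UNIV"
  proof -
    have "?B \<union> ?C = {i. 0 < i \<and> (i mod 18 = 0 \<or> i mod 18 = 17 \<or> i mod 18 = 1)}"
      by (auto intro: gr0I)
    then show ?thesis using jacobi_triple_product[of 17 1] by simp
  qed
  have C: "euler_prod ?C = gf (theta_exp 36 18) alt_sign UNIV"
  proof -
    have "?C = {i. 0 < i \<and> (i mod 54 = 0 \<or> i mod 54 = 36 \<or> i mod 54 = 18)}"
    proof -
      have "i mod 18 = 0 \<longleftrightarrow> i mod 54 = 0 \<or> i mod 54 = 36 \<or> i mod 54 = 18" for i :: nat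
      proof
        assume "i mod 18 = 0"
        then obtain c where i: "i = 18 * c" by auto
        have "c mod 3 = 0 \<or> c mod 3 = 1 \<or> c mod 3 = 2" by presburger
        then show "i mod 54 = 0 \<or> i mod 54 = 36 \<or> i mod 54 = 18"
          using mult_mod_right[of 18 c 3] unfolding i by auto
      next
        assume "i mod 54 = 0 \<or> i mod 54 = 36 \<or> i mod 54 = 18"
        then show "i mod 18 = 0" using mod_mod_cancel[of 18 54 i] by auto
      qed
      then show ?thesis by simp
    qed
    then show ?thesis using jacobi_triple_product[of 36 18] by simp
  qed
  have "euler_prod ?A * (euler_prod ?B * euler_prod ?C) = euler_prod ?A * euler_prod (?B \<union> ?C)"
    by (subst euler_prod_Un) auto
  also have "\<dots> = gf num_exp char3 (UNIV - {0}) * euler_prod ?C"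
    unfolding A B C by (rule quintuple_theta)
  finally have "euler_prod ?A * euler_prod ?B = gf num_exp char3 (UNIV - {0})"
    by (simp only: mult.assoc[symmetric] mult_cancel_right euler_prod_nonzero simp_thms)
  moreover have "?A \<inter> ?B = {}"
  proof -
    have "i mod 9 = 8 \<or> i mod 9 = 1" if "i mod 18 = 17 \<or> i mod 18 = 1" for i :: nat
      using that mod_mod_cancel[of 9 18 i] by auto
    then show ?thesis by fastforce
  qed
  ultimately show ?thesis by (subst euler_prod_Un) auto
qed

section \<open>A Bailey pair from the cube roots of unity\<close>

text \<open>Specialising the triple product to a constant \<open>a = -w\<close> with \<open>w\<^sup>3 = 1\<close>. The scalar in front of the
  power of \<open>q\<close> is \<open>w\<close> to the power \<open>tri k + 2 tri (-k) = 3 tri k - 2 k\<close>, hence depends only on \<open>k\<close>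
  modulo 3.\<close>

lemma theta_coeff_cube_root:
  fixes w :: complex
  assumes "w ^ 3 = 1"
  shows "theta_coeff (fps_const (- w)) (fps_const (- w\<^sup>2) * fps_X) k
     = fps_const (w ^ nat (k mod 3)) * fps_X ^ tri (- k)"
proof -
  \<comment> \<open>The two triangular numbers add up to the square of \<open>k\<close>, so all signs cancel.\<close>
  have par: "even (tri k + tri (- k)) \<longleftrightarrow> even (nat \<bar>k\<bar>)"
  proof -
    have "int (tri k + tri (- k)) = k * k"
      using int_tri[of k] tri_neg[of k] by (simp add: algebra_simps)
    then have "even (tri k + tri (- k)) \<longleftrightarrow> even (k * k)" by (metis even_of_nat_iff)
    then show ?thesis by (simp add: even_nat_iff)
  qed
  have red: "w ^ n = w ^ (n mod 3)" for n
    by (metis assms mult_div_mod_eq power_add power_mult power_one mult_1_left)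
  have "int (tri k + 2 * tri (- k)) = k + 3 * (int (tri k) - k)"
    using tri_neg[of k] by simp
  then have "int (tri k + 2 * tri (- k)) mod 3 = k mod 3"
    by (simp only: mod_mult_self2)
  then have md: "(tri k + 2 * tri (- k)) mod 3 = nat (k mod 3)"
    by (metis nat_int of_nat_mod of_nat_numeral)
  have "(-1) ^ nat \<bar>k\<bar> * (- w) ^ tri k * (- w\<^sup>2) ^ tri (- k)
     = (-1) ^ nat \<bar>k\<bar> * (-1) ^ (tri k + tri (- k)) * w ^ (tri k + 2 * tri (- k))"
    unfolding power_minus[of w] power_minus[of "w\<^sup>2"] by (simp add: power_add power_mult)
  also have "\<dots> = w ^ nat (k mod 3)"
    using red[of "tri k + 2 * tri (- k)"] par unfolding md by (auto simp: minus_one_power_iff)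
  finally have *: "(-1) ^ nat \<bar>k\<bar> * (- w) ^ tri k * (- w\<^sup>2) ^ tri (- k) = w ^ nat (k mod 3)" .
  have "theta_coeff (fps_const (- w)) (fps_const (- w\<^sup>2) * fps_X) k
     = fps_const ((-1) ^ nat \<bar>k\<bar> * (- w) ^ tri k * (- w\<^sup>2) ^ tri (- k)) * fps_X ^ tri (- k)"
    unfolding theta_coeff_def power_mult_distrib fps_const_power
    by (simp only: fps_const_mult[symmetric] fps_const_power[symmetric] fps_const_neg[symmetric] fps_const_1_eq_1 mult.assoc)
  then show ?thesis by (simp only: *)
qed

definition cubic_poly :: "nat \<Rightarrow> complex fps" where
  "cubic_poly N = (\<Prod>j\<in>{1..<N}. 1 - fps_X ^ j + fps_X ^ (2 * j))"

text \<open>With \<open>q = X\<close>, \<open>a = -w\<close> and \<open>b = -w\<^sup>2 X\<close>, the product consists of the pairs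
  \<open>(1 + w X^j) (1 + w\<^sup>2 X^j) = 1 - X^j + X^(2j)\<close> for \<open>1 \<le> j < N\<close> and of the unpaired factors
  \<open>1 + w = -w\<^sup>2\<close> and \<open>1 + w\<^sup>2 X^N\<close>.\<close>

lemma cube_root_triple_product:
  fixes w :: complex
  assumes w: "w\<^sup>2 + w + 1 = 0" and N: "N \<ge> 1"
  shows "(fps_const (- w\<^sup>2) - fps_const w * fps_X ^ N) * cubic_poly N * inv_qpoch fps_X (2 * int N)
    = (\<Sum>k\<in>{- int N..int N}. fps_const (w ^ nat (k mod 3)) * fps_X ^ tri (- k) *
         inv_qpoch fps_X (int N - k) * inv_qpoch fps_X (int N + k))"
proof -
  have "w ^ 3 - 1 = (w - 1) * (w\<^sup>2 + w + 1)" by algebra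
  with w have w3: "w ^ 3 = 1" by simp
  define a :: "complex fps" where "a = fps_const (- w)"
  define b :: "complex fps" where "b = fps_const (- w\<^sup>2) * fps_X"
  have "w * w\<^sup>2 = 1" using w3 by (simp add: power2_eq_square power3_eq_cube mult.assoc)
  then have "fps_const (- w) * fps_const (- w\<^sup>2) = 1" by (simp only: fps_const_mult) simp
  then have ab: "a * b = fps_X" unfolding a_def b_def by (simp only: mult.assoc[symmetric] mult_1_left)
  let ?S = "\<Sum>k\<in>{- int N..int N}. theta_coeff a b k * inv_qpoch fps_X (int N - k) * inv_qpoch fps_X (int N + k)"
  have "(\<Prod>j<N. 1 - a * fps_X ^ j) * (\<Prod>j<N. 1 - b * fps_X ^ j) = qpoch fps_X (N + N) * ?S"
    using finite_triple_product[of a b N N] unfolding ab by simp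
  then have S: "?S = (\<Prod>j<N. 1 - a * fps_X ^ j) * (\<Prod>j<N. 1 - b * fps_X ^ j) * inv_qpoch fps_X (2 * int N)"
    using qpoch_inverse[of fps_X "N + N"] inv_qpoch_nat[of fps_X "N + N"] by (simp add: mult_ac)
  obtain M where M: "N = Suc M" using N by (cases N) auto
  have "(\<Prod>j<N. 1 - a * fps_X ^ j) * (\<Prod>j<N. 1 - b * fps_X ^ j)
     = (1 - a) * (1 + fps_const (w\<^sup>2) * fps_X ^ N) * ((\<Prod>j<M. 1 - a * fps_X ^ Suc j) * (\<Prod>j<M. 1 + fps_const (w\<^sup>2) * fps_X ^ Suc j))"
    unfolding M prod.lessThan_Suc_shift[of "\<lambda>j. 1 - a * fps_X ^ j"] prod.lessThan_Suc[of "\<lambda>j. 1 - b * fps_X ^ j"]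
    by (simp add: b_def mult_ac fps_const_neg[symmetric] del: fps_const_neg)
  also have "(\<Prod>j<M. 1 - a * fps_X ^ Suc j) * (\<Prod>j<M. 1 + fps_const (w\<^sup>2) * fps_X ^ Suc j) = cubic_poly N"
  proof -
    have "(1 - a * x) * (1 + fps_const (w\<^sup>2) * x) = 1 - x + x\<^sup>2" for x
    proof -
      have "(1 - a * x) * (1 + fps_const (w\<^sup>2) * x) = 1 + fps_const (w\<^sup>2 + w) * x + fps_const (w * w\<^sup>2) * x\<^sup>2"
        unfolding a_def fps_const_neg[symmetric] fps_const_add[symmetric] fps_const_mult[symmetric] by algebra
      moreover have "w\<^sup>2 + w = - 1" using w by algebra
      ultimately show ?thesis using \<open>w * w\<^sup>2 = 1\<close> by (simp add: fps_const_neg[symmetric] del: fps_const_neg)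
    qed
    then have "(\<Prod>j<M. 1 - a * fps_X ^ Suc j) * (\<Prod>j<M. 1 + fps_const (w\<^sup>2) * fps_X ^ Suc j)
       = (\<Prod>j<M. 1 - fps_X ^ Suc j + (fps_X ^ Suc j)\<^sup>2)"
      unfolding prod.distrib[symmetric] by simp
    also have "\<dots> = cubic_poly N"
      unfolding cubic_poly_def M by (rule prod.reindex_bij_witness[of _ "\<lambda>j. j - 1" Suc]) (auto simp: power_mult power2_eq_square mult_ac)
    finally show ?thesis .
  qed
  also have "(1 - a) * (1 + fps_const (w\<^sup>2) * fps_X ^ N) = fps_const (- w\<^sup>2) - fps_const w * fps_X ^ N"
  proof -
    have "1 + w = - w\<^sup>2" using w by algebra
    then have "1 - a = fps_const (- w\<^sup>2)" by (simp add: a_def fps_const_1_eq_1[symmetric] fps_const_add del: fps_const_1_eq_1)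
    moreover have "- w\<^sup>2 * w\<^sup>2 = - w" using \<open>w * w\<^sup>2 = 1\<close> by algebra
    then have "fps_const (- w\<^sup>2) * fps_const (w\<^sup>2) = - fps_const w" by (simp only: fps_const_mult fps_const_neg)
    ultimately show ?thesis
      by (simp add: distrib_left mult.assoc[symmetric]) (simp add: fps_const_neg[symmetric] del: fps_const_neg)
  qed
  finally show ?thesis
    using S unfolding a_def b_def theta_coeff_cube_root[OF w3] by (simp only:)
qed

text \<open>The difference of the expansions for the two primitive cube roots of unity \<open>w\<close> and \<open>w\<^sup>2\<close>. On the
  left the prefactors combine to \<open>(w - w\<^sup>2) (1 - X^N)\<close>, which supplies the factor \<open>1 - X^N\<close>, and on
  the right \<open>w^k - w^(2k) = (w - w\<^sup>2) \<chi>(k)\<close>.\<close>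

lemma cubic_poly_expansion:
  assumes N: "N \<ge> 1"
  shows "(1 - fps_X ^ N) * cubic_poly N * inv_qpoch fps_X (2 * int N)
    = (\<Sum>k\<in>{- int N..int N}. fps_const (char3 k) * fps_X ^ tri (- k) *
         inv_qpoch fps_X (int N - k) * inv_qpoch fps_X (int N + k))"
proof -
  define w where "w = Complex (- 1 / 2) (sqrt 3 / 2)"
  have w: "w\<^sup>2 + w + 1 = 0"
    by (simp add: w_def complex_eq_iff power2_eq_square)
  have ne: "w - w\<^sup>2 \<noteq> 0"
    by (simp add: w_def complex_eq_iff power2_eq_square)
  have w4: "w ^ 4 = w"
    using w by algebra
  have w': "(w\<^sup>2)\<^sup>2 + w\<^sup>2 + 1 = 0"
    using w w4 by (simp add: power_mult[symmetric] add.commute add.left_commute)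
  let ?R = "inv_qpoch fps_X"
  have ch: "w ^ nat (k mod 3) - (w\<^sup>2) ^ nat (k mod 3) = (w - w\<^sup>2) * char3 k" for k
  proof -
    have "k mod 3 = 0 \<or> k mod 3 = 1 \<or> k mod 3 = 2" by presburger
    moreover have "(w\<^sup>2) ^ 2 = w" using w4 by (simp add: power_mult[symmetric])
    ultimately show ?thesis by (auto simp: char3_def)
  qed
  have "fps_const (w - w\<^sup>2) * ((1 - fps_X ^ N) * cubic_poly N * ?R (2 * int N))
     = (fps_const (- w\<^sup>2) - fps_const w * fps_X ^ N) * cubic_poly N * ?R (2 * int N)
       - (fps_const (- (w\<^sup>2)\<^sup>2) - fps_const (w\<^sup>2) * fps_X ^ N) * cubic_poly N * ?R (2 * int N)"
  proof -
    have "(w\<^sup>2)\<^sup>2 = w" using w4 by (simp add: power_mult[symmetric])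
    moreover have "(a - b) * ((1 - x) * p * r) = (- b - a * x) * p * r - (- a - b * x) * p * r"
      for a b x p r :: "complex fps" by algebra
    ultimately show ?thesis
      by (simp only: fps_const_sub[symmetric] fps_const_neg[symmetric])
  qed
  also have "\<dots> = (\<Sum>k\<in>{- int N..int N}. fps_const (w ^ nat (k mod 3) - (w\<^sup>2) ^ nat (k mod 3)) * fps_X ^ tri (- k) *
         ?R (int N - k) * ?R (int N + k))"
    unfolding cube_root_triple_product[OF w N] cube_root_triple_product[OF w' N] sum_subtractf[symmetric]
    by (simp add: left_diff_distrib fps_const_sub[symmetric] del: fps_const_sub)
  also have "\<dots> = fps_const (w - w\<^sup>2) * (\<Sum>k\<in>{- int N..int N}. fps_const (char3 k) * fps_X ^ tri (- k) *
         ?R (int N - k) * ?R (int N + k))"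
    unfolding ch by (simp only: fps_const_mult[symmetric] mult.assoc sum_distrib_left)
  finally show ?thesis
    using ne by (simp only: mult_cancel_left fps_const_eq_0_iff) simp
qed

text \<open>Up to a power of \<open>X\<close>, the generating function of the admissible signed partitions with largest
  positive part \<open>2 N\<close>.\<close>

definition signed_term :: "nat \<Rightarrow> complex fps" where
  "signed_term N = (1 - fps_X ^ N) * cubic_poly N * inv_qpoch fps_X (2 * int N)"

text \<open>The finite Bailey lemma for this pair: inserting the expansion of each term and exchanging the
  sums leaves, for every \<open>k\<close>, a sum over Durfee rectangles with \<open>r = 2 |k|\<close>. The additional factor
  \<open>1 / (q; q)\<^sub>L\<^sub>-\<^sub>N\<close> makes the identity exact for finite \<open>L\<close>.\<close>

lemma finite_bailey_sum:
  "(\<Sum>N\<in>{1..L}. fps_X ^ (N\<^sup>2 - 1) * (signed_term N * inv_qpoch fps_X (int L - int N)))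
   = (\<Sum>k\<in>{- int L..int L} - {0}. fps_X ^ num_exp k *
        (fps_const (char3 k) * (inv_qpoch fps_X (int L - k) * inv_qpoch fps_X (int L + k))))"
proof -
  let ?R = "inv_qpoch fps_X"
  let ?K = "{- int L..int L} - {0}"
  let ?t = "\<lambda>N k. fps_const (char3 k) * fps_X ^ tri (- k) * ?R (int N - k) * ?R (int N + k)"
  have "(\<Sum>N\<in>{1..L}. fps_X ^ (N\<^sup>2 - 1) * (signed_term N * ?R (int L - int N)))
     = (\<Sum>N\<in>{1..L}. \<Sum>k\<in>?K. fps_X ^ (N\<^sup>2 - 1) * (?t N k * ?R (int L - int N)))"
  proof (rule sum.cong)
    fix N assume N: "N \<in> {1..L}"
    then have "signed_term N = (\<Sum>k\<in>{- int N..int N}. ?t N k)"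
      unfolding signed_term_def by (intro cubic_poly_expansion) simp
    also have "\<dots> = (\<Sum>k\<in>?K. ?t N k)"
    proof -
      have "(\<Sum>k\<in>{- int N..int N}. ?t N k) = (\<Sum>k\<in>{- int N..int N} - {0}. ?t N k)"
        by (rule sum.mono_neutral_right) (auto simp: char3_def)
      also have "\<dots> = (\<Sum>k\<in>?K. ?t N k)"
        using N by (intro sum.mono_neutral_left) (auto dest!: inv_qpoch_nonzeroD)
      finally show ?thesis .
    qed
    finally show "fps_X ^ (N\<^sup>2 - 1) * (signed_term N * ?R (int L - int N))
       = (\<Sum>k\<in>?K. fps_X ^ (N\<^sup>2 - 1) * (?t N k * ?R (int L - int N)))"
      by (simp only: sum_distrib_left sum_distrib_right)
  qed simp
  also have "\<dots> = (\<Sum>k\<in>?K. \<Sum>N\<in>{1..L}. fps_X ^ (N\<^sup>2 - 1) * (?t N k * ?R (int L - int N)))"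
    by (rule sum.swap)
  also have "\<dots> = (\<Sum>k\<in>?K. fps_X ^ num_exp k * (fps_const (char3 k) * (?R (int L - k) * ?R (int L + k))))"
  proof (rule sum.cong)
    fix k assume k: "k \<in> ?K"
    define r where "r = nat \<bar>k\<bar>"
    have r: "1 \<le> r" "r \<le> L" using k by (auto simp: r_def)
    have sym: "?R (c - k) * ?R (c + k) = ?R (c - int r) * ?R (c + int r)" for c
      by (cases "k \<ge> 0") (simp_all add: r_def mult.commute)
    have "(\<Sum>N\<in>{1..L}. fps_X ^ (N\<^sup>2 - 1) * (?t N k * ?R (int L - int N)))
       = (\<Sum>N\<in>{1..L}. fps_X ^ (N\<^sup>2 - 1) * (fps_const (char3 k) * fps_X ^ tri (- k) * ?R (int N - int r) * ?R (int N + int r) * ?R (int L - int N)))"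
      by (rule sum.cong) (simp_all only: mult.assoc[of _ "?R (int _ - k)"] sym, simp_all only: mult.assoc)
    also have "\<dots> = (\<Sum>N\<in>{r..L}. fps_X ^ (N\<^sup>2 - 1) * (fps_const (char3 k) * fps_X ^ tri (- k) * ?R (int N - int r) * ?R (int N + int r) * ?R (int L - int N)))"
      using r by (intro sum.mono_neutral_right) (auto simp: inv_qpoch_neg)
    also have "\<dots> = (\<Sum>j\<le>L - r. fps_X ^ num_exp k * fps_const (char3 k) * (fps_X ^ (j * (j + 2 * r)) *
         ?R (int (L - r) - int j) * ?R (int j) * ?R (int j + int (2 * r))))"
    proof (rule sum.reindex_bij_witness[of _ "\<lambda>j. j + r" "\<lambda>N. N - r"])
      fix N assume N: "N \<in> {r..L}"
      define j where "j = N - r"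
      have Nj: "N = j + r" using N by (simp add: j_def)
      have "N\<^sup>2 - 1 + tri (- k) = num_exp k + j * (j + 2 * r)"
      proof -
        have "N\<^sup>2 = r\<^sup>2 + j * (j + 2 * r)" unfolding Nj by (simp add: power2_eq_square algebra_simps)
        moreover have "r\<^sup>2 \<ge> 1" using r by (simp add: Suc_le_eq)
        moreover have "num_exp k = r\<^sup>2 - 1 + tri (- k)" using k num_exp(2)[of k] by (simp add: r_def)
        ultimately show ?thesis by linarith
      qed
      then have pw: "fps_X ^ (N\<^sup>2 - 1) * fps_X ^ tri (- k) = fps_X ^ num_exp k * (fps_X ^ (j * (j + 2 * r)) :: complex fps)"
        by (simp only: power_add[symmetric])
      have ab: "e * c * (f * r1 * r2 * r3) = x * (c * y * r2 * r3 * r1)"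
        if "x * y = e * f" for e c f r1 r2 r3 x y :: "complex fps"
        using that by algebra
      have ints: "int N - int r = int j" "int N + int r = int j + int (2 * r)"
        "int L - int N = int (L - r) - int j" using Nj r N by (auto simp: of_nat_diff)
      show "fps_X ^ num_exp k * fps_const (char3 k) * (fps_X ^ ((N - r) * ((N - r) + 2 * r)) *
         ?R (int (L - r) - int (N - r)) * ?R (int (N - r)) * ?R (int (N - r) + int (2 * r)))
        = fps_X ^ (N\<^sup>2 - 1) * (fps_const (char3 k) * fps_X ^ tri (- k) * ?R (int N - int r) * ?R (int N + int r) * ?R (int L - int N))"
        unfolding j_def[symmetric] ints by (rule ab[OF pw])
    qed (use r in auto)
    also have "\<dots> = fps_X ^ num_exp k * fps_const (char3 k) * (?R (int (L - r)) * ?R (int (L - r) + int (2 * r)))"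
      unfolding sum_distrib_left[symmetric] by (subst durfee_rectangle_sum) simp_all
    also have "?R (int (L - r)) * ?R (int (L - r) + int (2 * r)) = ?R (int L - k) * ?R (int L + k)"
      unfolding sym using r by (simp add: of_nat_diff add.commute)
    finally show "(\<Sum>N\<in>{1..L}. fps_X ^ (N\<^sup>2 - 1) * (?t N k * ?R (int L - int N)))
      = fps_X ^ num_exp k * (fps_const (char3 k) * (?R (int L - k) * ?R (int L + k)))"
      by (simp only: mult.assoc)
  qed simp
  finally show ?thesis .
qed

text \<open>The limit \<open>L \<rightarrow> \<infinity>\<close> of the finite identity. The left-hand side tends to the sum divided by
  \<open>(q; q)\<^sub>\<infinity>\<close>, the right-hand side to the theta series divided by the square of \<open>(q; q)\<^sub>\<infinity>\<close>.\<close>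

lemma signed_series_theta:
  "(\<lambda>L. \<Sum>N\<in>{1..L}. fps_X ^ (N\<^sup>2 - 1) * signed_term N) \<longlonglongrightarrow>
     gf num_exp char3 (UNIV - {0}) * inverse (euler_prod {0<..})"
proof -
  let ?R = "inv_qpoch fps_X" and ?E = "inverse (euler_prod {0<..})"
  have R: "((\<lambda>L. ?R (int L + c)) \<longlongrightarrow> ?E) sequentially" for c
  proof -
    from tendsto_inv_qpoch[OF _ filterlim_int_add[of c], of 1] show ?thesis by (simp add: greaterThan_def)
  qed
  have ff: "fin_fibers num_exp (UNIV - {0})"
    by (rule fin_fibers_abs_le[of _ _ 1]) (use num_exp(3) in auto)
  have "(\<lambda>L. \<Sum>k\<in>{- int L..int L} - {0}. fps_X ^ num_exp k * (fps_const (char3 k) * (?R (int L - k) * ?R (int L + k))))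
      \<longlonglongrightarrow> gf num_exp char3 (UNIV - {0}) * (?E * ?E)"
  proof (rule tannery_fps[OF ff])
    fix k
    show "(\<lambda>L. fps_const (char3 k) * (?R (int L - k) * ?R (int L + k))) \<longlonglongrightarrow> fps_const (char3 k) * (?E * ?E)"
      using R[of "- k"] R[of k] by (intro tendsto_mult_fps tendsto_const) simp_all
  next
    have "(\<lambda>L. \<Sum>k\<in>{- int L..int L} - {0}. fps_X ^ num_exp k * fps_const (char3 k)) \<longlonglongrightarrow> gf num_exp char3 (UNIV - {0})"
    proof (rule tendsto_gf[OF ff])
      fix k :: int assume "k \<in> UNIV - {0}"
      then show "eventually (\<lambda>L. k \<in> {- int L..int L} - {0}) sequentially"
        by (intro eventually_sequentiallyI[of "nat \<bar>k\<bar>"]) auto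
    qed auto
    from tendsto_mult_fps[OF this tendsto_const]
    show "(\<lambda>L. \<Sum>k\<in>{- int L..int L} - {0}. fps_X ^ num_exp k * (fps_const (char3 k) * (?E * ?E)))
      \<longlonglongrightarrow> gf num_exp char3 (UNIV - {0}) * (?E * ?E)"
      by (simp only: sum_distrib_right mult.assoc)
  qed auto
  then have lim1: "(\<lambda>L. \<Sum>N\<in>{1..L}. fps_X ^ (N\<^sup>2 - 1) * (signed_term N * ?R (int L - int N)))
      \<longlonglongrightarrow> gf num_exp char3 (UNIV - {0}) * (?E * ?E)"
    by (simp only: finite_bailey_sum)
  have big: "N \<le> N\<^sup>2 - 1 + 1" if "N \<in> {1..}" for N :: nat
    using that mult_le_mono2[of 1 N N] by (simp add: power2_eq_square)
  have ffN: "fin_fibers (\<lambda>N :: nat. N\<^sup>2 - 1) {1..}"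
  proof (rule fin_fibersI)
    fix n
    have "{N \<in> {1..}. N\<^sup>2 - 1 \<le> n} \<subseteq> {..n + 1 :: nat}"
    proof
      fix N :: nat assume "N \<in> {N \<in> {1..}. N\<^sup>2 - 1 \<le> n}"
      then have "1 \<le> N" "N\<^sup>2 - 1 \<le> n" by simp_all
      with big[of N] show "N \<in> {..n + 1}" unfolding atLeast_iff atMost_iff by linarith
    qed
    then show "finite {N :: nat \<in> {1..}. N\<^sup>2 - 1 \<le> n}" by (rule finite_subset) simp
  qed
  \<comment> \<open>The sum of the series itself converges because its terms have increasing order.\<close>
  let ?S = "\<lambda>L. \<Sum>N\<in>{1..L}. fps_X ^ (N\<^sup>2 - 1) * signed_term N"
  define G where "G = Abs_fps (\<lambda>n. ?S (n + 1) $ n)"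
  have G: "?S \<longlonglongrightarrow> G"
  proof (rule tendsto_fpsI)
    fix n
    show "eventually (\<lambda>L. ?S L $ n = G $ n) sequentially"
    proof (rule eventually_sequentiallyI[of "n + 1"])
      fix L assume L: "n + 1 \<le> L"
      have "?S L $ n = (\<Sum>N\<in>{1..n + 1}. (fps_X ^ (N\<^sup>2 - 1) * signed_term N) $ n)"
        unfolding fps_sum_nth
      proof (rule sum.mono_neutral_right)
        show "\<forall>N\<in>{1..L} - {1..n + 1}. (fps_X ^ (N\<^sup>2 - 1) * signed_term N) $ n = 0"
        proof
          fix N assume "N \<in> {1..L} - {1..n + 1}"
          then have "n < N\<^sup>2 - 1" using big[of N] by auto
          then show "(fps_X ^ (N\<^sup>2 - 1) * signed_term N) $ n = 0" by (simp add: fps_X_power_mult_nth)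
        qed
      qed (use L in auto)
      then show "?S L $ n = G $ n" by (simp add: G_def fps_sum_nth)
    qed
  qed
  have "(\<lambda>L. \<Sum>N\<in>{1..L}. fps_X ^ (N\<^sup>2 - 1) * (signed_term N * ?R (int L - int N))) \<longlonglongrightarrow> G * ?E"
  proof (rule tannery_fps[OF ffN])
    show "(\<lambda>L. signed_term N * ?R (int L - int N)) \<longlonglongrightarrow> signed_term N * ?E" for N
      using R[of "- int N"] by (intro tendsto_mult_fps tendsto_const) simp
    from tendsto_mult_fps[OF G tendsto_const]
    show "(\<lambda>L. \<Sum>N\<in>{1..L}. fps_X ^ (N\<^sup>2 - 1) * (signed_term N * ?E)) \<longlonglongrightarrow> G * ?E"
      by (simp only: sum_distrib_right mult.assoc)
  qed auto
  from LIMSEQ_unique[OF this lim1]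
  have "G * ?E = gf num_exp char3 (UNIV - {0}) * ?E * ?E" by (simp add: mult.assoc)
  moreover have "?E $ 0 \<noteq> 0" by simp
  then have "?E \<noteq> 0" by (metis fps_zero_nth)
  ultimately have "G = gf num_exp char3 (UNIV - {0}) * ?E" by simp
  with G show ?thesis by simp
qed

lemma allowed_part_mod: "allowed_part x \<longleftrightarrow> x mod 18 \<in> {2, 3, 6, 7, 8, 10, 11, 12, 15, 16}"
proof -
  define y where "y = x mod 18"
  have y: "int x mod 18 = int y" by (simp add: y_def zmod_int)
  have num: "int y = numeral r \<longleftrightarrow> y = numeral r" for r
    by (metis of_nat_eq_iff of_nat_numeral)
  show ?thesis
    unfolding allowed_part_def cong_def y y_def[symmetric] by (simp add: num disj_ac)
qed

text \<open>The integers outside the ten allowed residue classes are exactly those in the quintuple product,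
  so dividing the latter by \<open>(q; q)\<^sub>\<infinity>\<close> leaves the allowed parts in the denominator.\<close>

lemma signed_series_product:
  "(\<lambda>L. \<Sum>N\<in>{1..L}. fps_X ^ (N\<^sup>2 - 1) * signed_term N) \<longlonglongrightarrow> inverse (euler_prod (Collect allowed_part))"
proof -
  define S where "S = Collect allowed_part"
  define T where "T = ({i. 0 < i \<and> (i mod 9 = 0 \<or> i mod 9 = 4 \<or> i mod 9 = 5)} \<union> {i. i mod 18 = 17 \<or> i mod 18 = 1} :: nat set)"
  have mem_T: "i \<in> T \<longleftrightarrow> 0 < i \<and> i \<notin> S" for i
  proof -
    define r where "r = i mod 18"
    have r: "i mod 9 = r mod 9" by (simp add: r_def mod_mod_cancel)
    have "\<forall>r\<in>{..<18 :: nat}. (r mod 9 = 0 \<or> r mod 9 = 4 \<or> r mod 9 = 5 \<or> r = 17 \<or> r = 1)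
        \<longleftrightarrow> r \<notin> {2, 3, 6, 7, 8, 10, 11, 12, 15, 16}"
      by code_simp
    moreover have "r \<in> {..<18}" by (simp add: r_def)
    ultimately have "(r mod 9 = 0 \<or> r mod 9 = 4 \<or> r mod 9 = 5 \<or> r = 17 \<or> r = 1)
        \<longleftrightarrow> r \<notin> {2, 3, 6, 7, 8, 10, 11, 12, 15, 16}"
      by (rule bspec)
    moreover have "r = 17 \<or> r = 1 \<Longrightarrow> 0 < i" by (auto simp: r_def intro: gr0I)
    ultimately show ?thesis
      unfolding S_def T_def Un_iff mem_Collect_eq allowed_part_mod r r_def[symmetric] by argo
  qed
  have S_pos: "0 < i" if "i \<in> S" for i
    using that by (auto simp: S_def allowed_part_mod intro: gr0I)
  have "{0<..} = T \<union> S"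
    using mem_T S_pos by blast
  moreover have "euler_prod (T \<union> S) = euler_prod T * euler_prod S"
  proof (rule euler_prod_Un)
    show "T \<inter> S = {}" using mem_T by blast
    show "0 \<notin> T" using mem_T[of 0] by blast
    show "0 \<notin> S" using S_pos[of 0] by blast
  qed
  ultimately have "gf num_exp char3 (UNIV - {0}) * inverse (euler_prod {0<..})
     = (euler_prod T * inverse (euler_prod T)) * inverse (euler_prod S)"
    unfolding quintuple_product_mod_18[folded T_def, symmetric] by (simp add: fps_inverse_mult mult.assoc)
  also have "euler_prod T * inverse (euler_prod T) = 1"
    by (rule inverse_mult_eq_1') simp
  finally show ?thesis using signed_series_theta by (simp add: S_def)
qed

section \<open>Generating functions of partitions\<close>

lemma inverse_one_minus_X_power:
  assumes "0 < i"
  shows "(1 - fps_X ^ i) * inverse (1 - fps_X ^ i :: complex fps) = 1"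
  using assms by (intro inverse_mult_eq_1') (simp add: fps_X_power_nth)

lemma fin_fibers_multiples:
  assumes "0 < i"
  shows "fin_fibers (\<lambda>c. c * i) (A :: nat set)"
proof (rule fin_fibersI)
  fix n
  have "c \<le> n" if "c * i \<le> n" for c
    using that assms mult_le_mono2[of 1 i c] by linarith
  then have "{c \<in> A. c * i \<le> n} \<subseteq> {..n}" by blast
  then show "finite {c \<in> A. c * i \<le> n}" by (rule finite_subset) simp
qed

lemma bij_betw_Suc: "bij_betw Suc UNIV {1..}"
  by (rule bij_betwI[of _ _ _ "\<lambda>n. n - 1"]) auto

lemma gf_multiplicity_any:
  assumes "0 < i"
  shows "gf (\<lambda>c :: nat. c * i) (\<lambda>_. 1) UNIV = inverse (1 - fps_X ^ i)"
proof -
  let ?G = "gf (\<lambda>c :: nat. c * i) (\<lambda>_. 1) UNIV"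
  have "(UNIV :: nat set) = {0} \<union> {1..}" by auto
  then have "?G = gf (\<lambda>c :: nat. c * i) (\<lambda>_. 1) {0} + gf (\<lambda>c. c * i) (\<lambda>_. 1) {1..}"
    using gf_Un[of "{0}" "{1..}" "\<lambda>c :: nat. c * i"] fin_fibers_multiples[OF assms] by simp
  also have "gf (\<lambda>c :: nat. c * i) (\<lambda>_. 1) {0} = 1"
    by (simp add: gf_finite)
  also have "gf (\<lambda>c. c * i) (\<lambda>_. 1) {1..} = gf (\<lambda>c. c * i + i) (\<lambda>_. 1) UNIV"
    by (rule gf_reindex[OF bij_betw_Suc, symmetric]) auto
  also have "\<dots> = fps_X ^ i * ?G" by (rule gf_shift)
  finally have "(1 - fps_X ^ i) * ?G = 1" by (simp add: algebra_simps)
  then have "inverse (1 - fps_X ^ i) * ((1 - fps_X ^ i) * ?G) = inverse (1 - fps_X ^ i)" by simp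
  then show ?thesis
    using inverse_one_minus_X_power[OF assms] by (simp add: mult.assoc[symmetric] mult.commute[of "inverse _"])
qed

lemma gf_multiplicity_pos:
  assumes "0 < i"
  shows "gf (\<lambda>c :: nat. c * i) (\<lambda>_. 1) {1..} = fps_X ^ i * inverse (1 - fps_X ^ i)"
proof -
  have "gf (\<lambda>c :: nat. c * i) (\<lambda>_. 1) {1..} = gf (\<lambda>c. c * i + i) (\<lambda>_. 1) UNIV"
    by (rule gf_reindex[OF bij_betw_Suc, symmetric]) auto
  then show ?thesis by (simp only: gf_shift gf_multiplicity_any[OF assms])
qed

lemma gf_multiplicity_even_pos:
  assumes "0 < i"
  shows "gf (\<lambda>c :: nat. c * i) (\<lambda>_. 1) {c. even c \<and> 2 \<le> c} = fps_X ^ (2 * i) * inverse (1 - fps_X ^ (2 * i))"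
proof -
  have "bij_betw (\<lambda>c. 2 * c) {1..} {c :: nat. even c \<and> 2 \<le> c}"
    by (auto simp: bij_betw_def inj_on_def image_iff elim!: evenE)
  then have "gf (\<lambda>c. c * i) (\<lambda>_. 1) {c. even c \<and> 2 \<le> c} = gf (\<lambda>c. c * (2 * i)) (\<lambda>_. 1) {1..}"
    by (rule gf_reindex[symmetric]) auto
  then show ?thesis using gf_multiplicity_pos[of "2 * i"] assms by simp
qed

text \<open>Multisets of elements of \<open>F\<close> with prescribed sets of multiplicities. Both the ordinary partitions
  into allowed parts and the positive parts of a signed partition have this form.\<close>

definition msets :: "nat set \<Rightarrow> (nat \<Rightarrow> nat set) \<Rightarrow> nat multiset set" where
  "msets F C = {M. set_mset M \<subseteq> F \<and> (\<forall>i\<in>F. count M i \<in> C i)}"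

text \<open>The multiplicities of distinct parts are chosen independently.\<close>

lemma gf_msets:
  assumes "finite F" "0 \<notin> F"
  shows "fin_fibers sum_mset (msets F C)
     \<and> gf sum_mset (\<lambda>_. 1) (msets F C) = (\<Prod>i\<in>F. gf (\<lambda>c. c * i) (\<lambda>_. 1) (C i))"
  using assms
proof (induction F rule: finite_induct)
  case empty
  have "msets {} C = {{#}}" by (auto simp: msets_def)
  then show ?case by (simp add: gf_finite fin_fibers_def)
next
  case (insert x F)
  let ?f = "\<lambda>(c, M). M + replicate_mset c x"
  let ?w = "\<lambda>(c, M). c * x + sum_mset M"
  have x: "0 < x" and IH: "fin_fibers sum_mset (msets F C)"
      "gf sum_mset (\<lambda>_. 1) (msets F C) = (\<Prod>i\<in>F. gf (\<lambda>c. c * i) (\<lambda>_. 1) (C i))"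
    using insert by auto
  have bij: "bij_betw ?f (C x \<times> msets F C) (msets (insert x F) C)"
  proof (rule bij_betwI[of _ _ _ "\<lambda>M. (count M x, filter_mset (\<lambda>y. y \<noteq> x) M)"])
    show "?f \<in> C x \<times> msets F C \<rightarrow> msets (insert x F) C"
    proof
      fix p assume p: "p \<in> C x \<times> msets F C"
      obtain c M where cM: "p = (c, M)" by (cases p)
      then have M: "set_mset M \<subseteq> F" "c \<in> C x" "\<And>i. i \<in> F \<Longrightarrow> count M i \<in> C i"
        using p by (auto simp: msets_def)
      moreover have "count M x = 0" using M(1) insert.hyps by (auto simp: count_eq_zero_iff)
      ultimately show "?f p \<in> msets (insert x F) C"
        using insert.hyps by (auto simp: cM msets_def split: if_splits)
    qed
    show "(\<lambda>M. (count M x, filter_mset (\<lambda>y. y \<noteq> x) M)) \<in> msets (insert x F) C \<rightarrow> C x \<times> msets F C"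
      using insert.hyps by (auto simp: msets_def)
    show "(\<lambda>M. (count M x, filter_mset (\<lambda>y. y \<noteq> x) M)) (?f p) = p" if "p \<in> C x \<times> msets F C" for p
      using that insert.hyps by (auto simp: msets_def multiset_eq_iff count_eq_zero_iff subset_iff)
    show "?f ((\<lambda>M. (count M x, filter_mset (\<lambda>y. y \<noteq> x) M)) M) = M" for M
      by (auto simp: multiset_eq_iff)
  qed
  have weight: "?w p = sum_mset (?f p)" for p
    by (cases p) (simp add: sum_mset_replicate_mset)
  note ffx = fin_fibers_multiples[OF x, of "C x"]
  have "fin_fibers sum_mset (msets (insert x F) C)"
    by (rule fin_fibers_bij[OF bij weight fin_fibers_Times[OF ffx IH(1)]])
  moreover have "gf sum_mset (\<lambda>_. 1) (msets (insert x F) C) = gf ?w (\<lambda>(c, M). 1 * 1) (C x \<times> msets F C)"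
    by (rule gf_reindex[OF bij, symmetric]) (auto simp: sum_mset_replicate_mset)
  ultimately show ?case
    using gf_Times[OF ffx IH(1), of "\<lambda>_. 1" "\<lambda>_. 1"] IH(2) insert.hyps by simp
qed

definition parts_desc :: "nat multiset \<Rightarrow> nat list" where
  "parts_desc M = rev (sorted_list_of_multiset M)"

lemma mset_parts_desc [simp]: "mset (parts_desc M) = M"
  by (simp add: parts_desc_def)

lemma set_parts_desc [simp]: "set (parts_desc M) = set_mset M"
  by (simp add: parts_desc_def)

lemma is_partition_parts_desc: "0 \<notin># M \<Longrightarrow> is_partition (parts_desc M)"
  unfolding is_partition_def by (auto simp: parts_desc_def sorted_wrt_rev intro: gr0I)

lemma parts_desc_mset: "is_partition p \<Longrightarrow> parts_desc (mset p) = p"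
proof -
  assume "is_partition p"
  then have "sorted (rev p)" by (simp add: is_partition_def sorted_wrt_rev)
  then have "sort (rev p) = rev p" by (rule sorted_sort_id)
  moreover have "sort p = sort (rev p)" by (rule properties_for_sort) simp_all
  ultimately show ?thesis by (simp add: parts_desc_def)
qed

lemma hd_partition:
  assumes "is_partition p" "h \<in> set p" "\<And>x. x \<in> set p \<Longrightarrow> x \<le> h"
  shows "hd p = h"
proof (cases p)
  case (Cons a q)
  then show ?thesis using assms by (force simp: is_partition_def)
qed (use assms in simp)

lemma partition_le_hd: "is_partition p \<Longrightarrow> x \<in> set p \<Longrightarrow> x \<le> hd p"
  by (cases p) (auto simp: is_partition_def)

text \<open>Parts exceeding \<open>N \<ge> n\<close> cannot occur, so the finite product already gives the number of
  partitions of \<open>n\<close> into parts from \<open>S\<close>.\<close>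

lemma card_partitions_into:
  assumes "0 \<notin> S" "n \<le> N"
  shows "of_nat (card {p. partition_of n p \<and> set p \<subseteq> S})
     = inverse (\<Prod>i\<in>S \<inter> {1..N}. 1 - fps_X ^ i :: complex fps) $ n"
proof -
  let ?F = "S \<inter> {1..N}"
  have "bij_betw mset {p. partition_of n p \<and> set p \<subseteq> S} {M \<in> msets ?F (\<lambda>_. UNIV). sum_mset M = n}"
  proof (rule bij_betwI[of _ _ _ parts_desc])
    show "mset \<in> {p. partition_of n p \<and> set p \<subseteq> S} \<rightarrow> {M \<in> msets ?F (\<lambda>_. UNIV). sum_mset M = n}"
    proof
      fix p assume p: "p \<in> {p. partition_of n p \<and> set p \<subseteq> S}"
      have "x \<in> ?F" if "x \<in> set p" for x
      proof -
        have "x \<le> sum_list p" using that by (intro member_le_sum_list) auto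
        then show ?thesis using p that assms by (auto simp: partition_of_def is_partition_def Suc_le_eq)
      qed
      then show "mset p \<in> {M \<in> msets ?F (\<lambda>_. UNIV). sum_mset M = n}"
        using p by (auto simp: msets_def partition_of_def sum_mset_sum_list)
    qed
    show "parts_desc \<in> {M \<in> msets ?F (\<lambda>_. UNIV). sum_mset M = n} \<rightarrow> {p. partition_of n p \<and> set p \<subseteq> S}"
    proof
      fix M assume M: "M \<in> {M \<in> msets ?F (\<lambda>_. UNIV). sum_mset M = n}"
      then have "is_partition (parts_desc M)" by (intro is_partition_parts_desc) (auto simp: msets_def)
      moreover have "sum_list (parts_desc M) = n"
        using M by (simp add: sum_mset_sum_list[symmetric])
      ultimately show "parts_desc M \<in> {p. partition_of n p \<and> set p \<subseteq> S}"
        using M by (auto simp: msets_def partition_of_def)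
    qed
  qed (auto simp: partition_of_def parts_desc_mset)
  then have "card {p. partition_of n p \<and> set p \<subseteq> S} = card {M \<in> msets ?F (\<lambda>_. UNIV). sum_mset M = n}"
    by (rule bij_betw_same_card)
  then have "of_nat (card {p. partition_of n p \<and> set p \<subseteq> S}) = gf sum_mset (\<lambda>_. 1) (msets ?F (\<lambda>_. UNIV)) $ n"
    by (simp add: gf_count)
  also have "gf sum_mset (\<lambda>_. 1) (msets ?F (\<lambda>_. UNIV)) = (\<Prod>i\<in>?F. gf (\<lambda>c. c * i) (\<lambda>_. 1) UNIV)"
    using gf_msets[of ?F "\<lambda>_. UNIV"] by simp
  also have "\<dots> = inverse (\<Prod>i\<in>?F. 1 - fps_X ^ i)"
    unfolding inverse_prod_fps by (rule prod.cong) (auto simp: gf_multiplicity_any)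
  finally show ?thesis .
qed

section \<open>Encoding and counting the signed partitions\<close>

text \<open>The multiplicities that the conditions on the positive parts allow for the part \<open>i\<close>, when the largest
  part is \<open>2 k\<close>.\<close>

definition pos_mults :: "nat \<Rightarrow> nat \<Rightarrow> nat set" where
  "pos_mults k i = (if i < k then {c. even c \<and> 2 \<le> c} else if i = k then {0} else {1..})"

text \<open>The multiset \<open>{4, 7, \<dots>, 3 k - 2}\<close> in which \<open>3 j + 1\<close> is replaced by \<open>1\<close> for every \<open>j \<in> T\<close>. Encoding by
  the missing parts, rather than by the present ones, makes larger sets \<open>T\<close> correspond to smaller
  negative weight, so only nonnegative exponents arise.\<close>

definition negative_parts :: "nat \<Rightarrow> nat set \<Rightarrow> nat multiset" where
  "negative_parts k T = mset_set ((\<lambda>j. 3 * j + 1) ` ({1..<k} - T)) + replicate_mset (card T) 1"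

lemma count_negative_parts:
  assumes "T \<subseteq> {1..<k}"
  shows "count (negative_parts k T) x =
    (if x = 1 then card T else if \<exists>j\<in>{1..<k} - T. x = 3 * j + 1 then 1 else 0)"
  unfolding negative_parts_def by (auto simp: count_mset_set' image_iff)

lemma negative_parts_size_sum:
  assumes T: "T \<subseteq> {1..<k}"
  shows "size (negative_parts k T) = k - 1"
    and "sum_mset (negative_parts k T) + (\<Sum>j\<in>T. 3 * j) = (\<Sum>j\<in>{1..<k}. 3 * j + 1)"
proof -
  have fin: "finite T" using T finite_subset by blast
  have inj: "inj_on (\<lambda>j :: nat. 3 * j + 1) B" for B by (simp add: inj_on_def)
  have "card ({1..<k} - T) + card T = k - 1"
    using card_Diff_subset[OF fin T] card_mono[OF _ T] by simp
  then show "size (negative_parts k T) = k - 1"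
    by (simp add: negative_parts_def card_image[OF inj, simplified])
  have "sum_mset (negative_parts k T) = (\<Sum>j\<in>{1..<k} - T. 3 * j + 1) + card T"
    unfolding negative_parts_def
    by (simp add: sum_mset_replicate_mset sum_unfold_sum_mset[symmetric, of "\<lambda>x. x", simplified] sum.reindex[OF inj, simplified])
  moreover have "(\<Sum>j\<in>{1..<k}. 3 * j + 1) = (\<Sum>j\<in>{1..<k} - T. 3 * j + 1) + (\<Sum>j\<in>T. 3 * j + 1)"
    by (rule sum.subset_diff[OF T]) simp
  moreover have "(\<Sum>j\<in>T. 3 * j + 1) = (\<Sum>j\<in>T. 3 * j) + card T"
    by (simp add: sum.distrib sum_Suc)
  ultimately show "sum_mset (negative_parts k T) + (\<Sum>j\<in>T. 3 * j) = (\<Sum>j\<in>{1..<k}. 3 * j + 1)"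
    by simp
qed

text \<open>Parts other than 1 occur at most once and are recorded by the set; the number of ones is then
  determined by the total number of parts.\<close>

lemma negative_parts_unique:
  assumes sz: "size V = k - 1"
    and form: "\<And>x. x \<in># V \<Longrightarrow> [x = 1] (mod 3) \<and> x \<le> 3 * k - 2"
    and dist: "\<And>x. x \<in># V \<Longrightarrow> 1 < x \<Longrightarrow> count V x \<le> 1"
  shows "negative_parts k {j \<in> {1..<k}. 3 * j + 1 \<notin># V} = V"
proof -
  let ?T = "{j \<in> {1..<k}. 3 * j + 1 \<notin># V}"
  let ?N = "negative_parts k ?T"
  have T: "?T \<subseteq> {1..<k}" by auto
  have cnt: "count ?N x = count V x" if "x \<noteq> 1" for x
  proof (cases "x \<in># V")
    case True
    then have f: "[x = 1] (mod 3)" "x \<le> 3 * k - 2" using form by auto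
    then have "x mod 3 = 1" by (simp add: cong_def)
    then have "x = 3 * (x div 3) + 1" by presburger
    moreover have "1 \<le> x div 3" using calculation that by presburger
    moreover have "x div 3 < k" using calculation(1) f(2) by presburger
    ultimately have "\<exists>j\<in>{1..<k} - ?T. x = 3 * j + 1" using True by (intro bexI[of _ "x div 3"]) auto
    moreover have "count V x = 1"
      using dist[OF True] True \<open>1 \<le> x div 3\<close> by (simp add: le_antisym Suc_le_eq count_greater_zero_iff)
    ultimately show ?thesis unfolding count_negative_parts[OF T] using that by simp
  next
    case False
    then have "\<not> (\<exists>j\<in>{1..<k} - ?T. x = 3 * j + 1)" by auto
    then show ?thesis unfolding count_negative_parts[OF T] using that False by (simp add: not_in_iff)
  qed
  have fl: "filter_mset (\<lambda>x. x \<noteq> 1) ?N = filter_mset (\<lambda>x. x \<noteq> 1) V"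
    using cnt by (auto simp: multiset_eq_iff)
  have "size (filter_mset (\<lambda>x. x \<noteq> 1) M) + count M 1 = size M" for M :: "nat multiset"
    by (induction M) auto
  from this[of ?N] this[of V] have "count ?N 1 = count V 1"
    unfolding fl sz negative_parts_size_sum(1)[OF T] by linarith
  show ?thesis
  proof (rule multiset_eqI)
    show "count ?N x = count V x" for x
      using \<open>count ?N 1 = count V 1\<close> cnt by (cases "x = 1") simp_all
  qed
qed

definition signed_data :: "nat \<Rightarrow> (nat multiset \<times> nat set) set" where
  "signed_data k = msets {1..2 * k} (pos_mults k) \<times> Pow {1..<k}"

definition signed_weight :: "nat multiset \<times> nat set \<Rightarrow> nat" where
  "signed_weight = (\<lambda>(M, T). sum_mset M + (\<Sum>j\<in>T. 3 * j))"

definition neg_total :: "nat \<Rightarrow> nat" where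
  "neg_total k = (\<Sum>j\<in>{1..<k}. 3 * j + 1)"

text \<open>The largest part determines \<open>k\<close>, and the condition on the weights reads
  \<open>|\<pi>| + 3 \<Sum>T = n + 2 + (4 + 7 + \<dots> + (3 k - 2))\<close>.\<close>

lemma bij_signed_data:
  "bij_betw (\<lambda>(k, M, T). (parts_desc M, parts_desc (negative_parts k T)))
     (SIGMA k:{1..}. {b \<in> signed_data k. signed_weight b = n + 2 + neg_total k})
     {\<sigma>. signed_partition_of (int n + 2) \<sigma> \<and> admissible \<sigma>}"
    (is "bij_betw ?f ?D ?A")
proof (rule bij_betwI[of _ _ _ "\<lambda>(p, v). let k = hd p div 2 in (k, mset p, {j \<in> {1..<k}. 3 * j + 1 \<notin> set v})"])
  let ?g = "\<lambda>(p, v). let k = hd p div 2 in (k, mset p, {j \<in> {1..<k}. 3 * j + 1 \<notin> set v})"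
  have D: "is_partition (parts_desc M)" "hd (parts_desc M) = 2 * k" "T \<subseteq> {1..<k}" "k \<ge> 1"
      "M \<in> msets {1..2 * k} (pos_mults k)" "sum_mset M + (\<Sum>j\<in>T. 3 * j) = n + 2 + neg_total k"
    if "(k, M, T) \<in> ?D" for k M T
  proof -
    show k: "k \<ge> 1" and T: "T \<subseteq> {1..<k}" and M: "M \<in> msets {1..2 * k} (pos_mults k)"
      and "sum_mset M + (\<Sum>j\<in>T. 3 * j) = n + 2 + neg_total k"
      using that by (auto simp: signed_data_def signed_weight_def)
    show part: "is_partition (parts_desc M)"
      using M by (intro is_partition_parts_desc) (auto simp: msets_def)
    have "2 * k \<in># M"
    proof -
      have "count M (2 * k) \<in> pos_mults k (2 * k)" using M k by (auto simp: msets_def)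
      then show ?thesis using k by (auto simp: pos_mults_def Suc_le_eq)
    qed
    then show "hd (parts_desc M) = 2 * k"
      using M by (intro hd_partition[OF part]) (auto simp: msets_def)
  qed
  show "?f \<in> ?D \<rightarrow> ?A"
  proof
    fix d assume d: "d \<in> ?D"
    obtain k M T where kMT: "d = (k, M, T)" by (cases d)
    note D = D[OF d[unfolded kMT]]
    let ?V = "negative_parts k T"
    have V0: "0 \<notin># ?V"
      using D(3) by (simp add: count_negative_parts not_in_iff)
    have memV: "[x = 1] (mod 3) \<and> x \<le> 3 * k - 2 \<and> (1 < x \<longrightarrow> count ?V x \<le> 1)" if "x \<in># ?V" for x
    proof -
      have "x = 1 \<or> (\<exists>j\<in>{1..<k} - T. x = 3 * j + 1)"
        using that count_negative_parts[OF D(3), of x] by (auto simp: count_greater_zero_iff[symmetric] split: if_splits simp del: count_greater_zero_iff)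
      then have "[x = 1] (mod 3) \<and> x \<le> 3 * k - 2" using D(4) by (auto simp: cong_def)
      then show ?thesis by (simp add: count_negative_parts[OF D(3)])
    qed
    have M: "count M i \<in> pos_mults k i" if "1 \<le> i" "i \<le> 2 * k" for i
      using D(5) that by (auto simp: msets_def)
    have "signed_partition_of (int n + 2) (parts_desc M, parts_desc ?V)"
    proof -
      have "sum_list (parts_desc M) = sum_mset M" "sum_list (parts_desc ?V) = sum_mset ?V"
        by (simp_all add: sum_mset_sum_list[symmetric])
      moreover have "sum_mset M = n + 2 + sum_mset ?V"
        using D(6) negative_parts_size_sum(2)[OF D(3)] unfolding neg_total_def by linarith
      ultimately show ?thesis using D(1) is_partition_parts_desc[OF V0] by simp
    qed
    moreover have "admissible (parts_desc M, parts_desc ?V)"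
    proof -
      have cl: "count_list (parts_desc N) i = count N i" for N i
        by (simp add: count_mset[symmetric])
      have "parts_desc M \<noteq> []" 
      proof
        assume "parts_desc M = []"
        then have "M = {#}" by (metis mset.simps(1) mset_parts_desc)
        then show False using M[of "2 * k"] D(4) by (simp add: pos_mults_def)
      qed
      moreover have "even (count M i) \<and> 2 \<le> count M i" if "i \<in> {1..k - 1}" for i
      proof -
        have "1 \<le> i" "i < k" using that by auto
        then show ?thesis using M[of i] by (simp add: pos_mults_def)
      qed
      moreover have "k \<notin># M"
        using M[of k] D(4) by (simp add: pos_mults_def not_in_iff)
      moreover have "1 \<le> count M i" if "i \<in> {k + 1..2 * k}" for i
        using M[of i] that by (auto simp: pos_mults_def split: if_splits)
      moreover have "length (parts_desc ?V) = k - 1"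
        using negative_parts_size_sum(1)[OF D(3)] by (metis mset_parts_desc size_mset)
      moreover have "3 * (2 * k) div 2 = 3 * k" by simp
      ultimately show ?thesis
        using memV unfolding admissible.simps D(2) cl set_parts_desc by auto
    qed
    ultimately show "?f d \<in> ?A" by (simp add: kMT del: signed_partition_of.simps admissible.simps)
  qed
  show "?g \<in> ?A \<rightarrow> ?D" and "\<And>\<sigma>. \<sigma> \<in> ?A \<Longrightarrow> ?f (?g \<sigma>) = \<sigma>"
  proof -
    have A: "?g (p, v) \<in> ?D \<and> ?f (?g (p, v)) = (p, v)" if "(p, v) \<in> ?A" for p v
    proof -
      define k where "k = hd p div 2"
      let ?T = "{j \<in> {1..<k}. 3 * j + 1 \<notin> set v}"
      have sp: "is_partition p" "is_partition v" "int n + 2 = int (sum_list p) - int (sum_list v)"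
        using that by auto
      have adm: "admissible (p, v)" using that by simp
      have hd: "hd p = 2 * k" using adm by (auto simp: k_def)
      have "hd p \<in> set p" using adm by simp
      then have k: "k \<ge> 1" using sp(1) hd by (force simp: is_partition_def)
      have c1: "even (count (mset p) i) \<and> 2 \<le> count (mset p) i" if "1 \<le> i" "i < k" for i
        using adm that by (auto simp: count_mset hd)
      have c2: "k \<notin> set p" using adm by (simp add: hd)
      have c3: "1 \<le> count (mset p) i" if "k < i" "i \<le> 2 * k" for i
        using adm that by (auto simp: count_mset hd Suc_le_eq)
      have v: "length v = k - 1" "\<And>x. x \<in> set v \<Longrightarrow> [x = 1] (mod 3) \<and> x \<le> 3 * k - 2"
        "\<And>x. x \<in> set v \<Longrightarrow> 1 < x \<Longrightarrow> count (mset v) x \<le> 1"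
        using adm by (auto simp: hd count_mset)
      have neg: "negative_parts k ?T = mset v"
        using negative_parts_unique[of "mset v" k] v by simp
      have "set p \<subseteq> {1..2 * k}"
        using sp(1) partition_le_hd[OF sp(1)] hd by (auto simp: is_partition_def Suc_le_eq)
      moreover have "count (mset p) i \<in> pos_mults k i" if "i \<in> {1..2 * k}" for i
        using c1[of i] c2 c3[of i] that by (auto simp: pos_mults_def)
      ultimately have "mset p \<in> msets {1..2 * k} (pos_mults k)" by (simp add: msets_def)
      moreover have "sum_mset (mset p) + (\<Sum>j\<in>?T. 3 * j) = n + 2 + neg_total k"
      proof -
        have "?T \<subseteq> {1..<k}" by auto
        from negative_parts_size_sum(2)[OF this] sp(3) show ?thesis
          unfolding neg neg_total_def sum_mset_sum_list by linarith
      qed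
      ultimately have "(k, mset p, ?T) \<in> ?D"
        using k by (auto simp: signed_data_def signed_weight_def)
      moreover have "?f (k, mset p, ?T) = (p, v)"
        using sp neg by (simp add: parts_desc_mset)
      ultimately show ?thesis by (simp add: k_def Let_def)
    qed
    show "?g \<in> ?A \<rightarrow> ?D"
    proof
      fix \<sigma> assume "\<sigma> \<in> ?A"
      then show "?g \<sigma> \<in> ?D" using A[of "fst \<sigma>" "snd \<sigma>"] by (simp only: prod.collapse)
    qed
    show "?f (?g \<sigma>) = \<sigma>" if "\<sigma> \<in> ?A" for \<sigma>
      using that A[of "fst \<sigma>" "snd \<sigma>"] by (simp only: prod.collapse)
  qed
  show "?g (?f d) = d" if "d \<in> ?D" for d
  proof -
    obtain k M T where kMT: "d = (k, M, T)" by (cases d)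
    note D = D[OF that[unfolded kMT]]
    have "3 * j + 1 \<in># negative_parts k T \<longleftrightarrow> j \<notin> T" if "j \<in> {1..<k}" for j
      using that unfolding count_greater_zero_iff[symmetric] count_negative_parts[OF D(3)] by auto
    then have "{j \<in> {1..<k}. 3 * j + 1 \<notin># negative_parts k T} = T" using D(3) by auto
    then show ?thesis using D(2) by (simp add: kMT Let_def)
  qed
qed

text \<open>Both sides equal \<open>1 + y\<^sup>3\<close> divided by \<open>1 - y\<^sup>2\<close> for \<open>y = X^j\<close>, with the common factor
  \<open>1 + y\<close> cancelled on the right. This combines the parts smaller than \<open>k\<close> with the negative parts
  into a factor of \<open>cubic_poly\<close>.\<close>

lemma inverse_factor_pair:
  assumes "0 < j"
  shows "inverse (1 - fps_X ^ (2 * j)) * (1 + fps_X ^ (3 * j))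
     = inverse (1 - fps_X ^ j) * (1 - fps_X ^ j + fps_X ^ (2 * j) :: complex fps)"
proof -
  define y :: "complex fps" where "y = fps_X ^ j"
  have y: "fps_X ^ (2 * j) = y\<^sup>2" "fps_X ^ (3 * j) = y ^ 3"
    by (simp_all add: y_def power_mult[symmetric] mult.commute)
  have y0: "y $ 0 = 0" using assms by (simp add: y_def)
  have "(1 + y) * inverse (1 + y) = 1"
    by (rule inverse_mult_eq_1') (simp add: y0)
  moreover have "1 - y\<^sup>2 = (1 - y) * (1 + y)" "1 + y ^ 3 = (1 + y) * (1 - y + y\<^sup>2)" by algebra+
  ultimately show ?thesis
    unfolding y y_def[symmetric] by (simp add: fps_inverse_mult mult_ac)
qed

text \<open>The obligatory copies of the positive parts contribute
  \<open>2 (1 + \<dots> + (k - 1)) + (k + 1) + \<dots> + 2 k\<close> to the weight, which exceeds the total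
  \<open>4 + 7 + \<dots> + (3 k - 2)\<close> by exactly \<open>k\<^sup>2 + 1\<close>. The remaining choices are free and yield the
  product in the term with index \<open>k\<close>.\<close>

lemma gf_signed_data:
  assumes k: "k \<ge> 1"
  shows "fin_fibers signed_weight (signed_data k)"
    and "gf signed_weight (\<lambda>_. 1) (signed_data k) = fps_X ^ (neg_total k + 2) * (fps_X ^ (k\<^sup>2 - 1) * signed_term k)"
proof -
  let ?P = "msets {1..2 * k} (pos_mults k)" and ?W = "\<lambda>T. \<Sum>j\<in>T. 3 * j :: nat"
  let ?inv = "\<lambda>i. inverse (1 - fps_X ^ i :: complex fps)"
  have P: "fin_fibers sum_mset ?P"
      "gf sum_mset (\<lambda>_. 1) ?P = (\<Prod>i\<in>{1..2 * k}. gf (\<lambda>c. c * i) (\<lambda>_. 1) (pos_mults k i))"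
    using gf_msets[of "{1..2 * k}" "pos_mults k"] by simp_all
  have T: "fin_fibers ?W (Pow {1..<k})" by (simp add: fin_fibers_def)
  show "fin_fibers signed_weight (signed_data k)"
    unfolding signed_weight_def signed_data_def by (rule fin_fibers_Times[OF P(1) T])
  have split: "{1..2 * k} = {1..<k} \<union> ({k} \<union> {k<..2 * k})" using k by auto
  have prod_split: "(\<Prod>i\<in>{1..2 * k}. f i) = (\<Prod>i\<in>{1..<k}. f i) * (f k * (\<Prod>i\<in>{k<..2 * k}. f i))"
    for f :: "nat \<Rightarrow> complex fps"
    unfolding split by (subst prod.union_disjoint; (subst prod.union_disjoint)?) auto
  have "gf sum_mset (\<lambda>_. 1) ?P
     = (\<Prod>i\<in>{1..<k}. fps_X ^ (2 * i) * ?inv (2 * i)) * (\<Prod>i\<in>{k<..2 * k}. fps_X ^ i * ?inv i)"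
  proof -
    have "gf (\<lambda>c. c * k) (\<lambda>_. 1) (pos_mults k k) = 1"
      by (simp add: pos_mults_def gf_finite)
    moreover have "(\<Prod>i\<in>{1..<k}. gf (\<lambda>c. c * i) (\<lambda>_. 1) (pos_mults k i)) = (\<Prod>i\<in>{1..<k}. fps_X ^ (2 * i) * ?inv (2 * i))"
      by (rule prod.cong) (simp_all add: pos_mults_def gf_multiplicity_even_pos)
    moreover have "(\<Prod>i\<in>{k<..2 * k}. gf (\<lambda>c. c * i) (\<lambda>_. 1) (pos_mults k i)) = (\<Prod>i\<in>{k<..2 * k}. fps_X ^ i * ?inv i)"
    proof (rule prod.cong)
      fix i assume "i \<in> {k<..2 * k}"
      then have "pos_mults k i = {1..}" "0 < i" by (auto simp: pos_mults_def)
      then show "gf (\<lambda>c. c * i) (\<lambda>_. 1) (pos_mults k i) = fps_X ^ i * ?inv i"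
        by (simp only: gf_multiplicity_pos)
    qed simp
    ultimately show ?thesis unfolding P(2) prod_split by (simp only: mult_1_left)
  qed
  also have "\<dots> = fps_X ^ ((\<Sum>i\<in>{1..<k}. 2 * i) + \<Sum>{k<..2 * k}) * ((\<Prod>i\<in>{1..<k}. ?inv (2 * i)) * (\<Prod>i\<in>{k<..2 * k}. ?inv i))"
    by (simp only: prod.distrib power_sum[symmetric] power_add mult_ac)
  also have "(\<Sum>i\<in>{1..<k}. 2 * i) + \<Sum>{k<..2 * k} = neg_total k + 2 + (k\<^sup>2 - 1)"
  proof -
    have "(\<Sum>i\<in>{1..<k}. 2 * i) + \<Sum>{k<..2 * k} = neg_total k + k\<^sup>2 + 1"
      using k
    proof (induction k rule: dec_induct)
      case base
      have "{1<..2} = {2 :: nat}" by auto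
      then show ?case by (simp add: neg_total_def)
    next
      case (step k)
      have "\<Sum>{k<..2 * k} + (2 * k + 1) + (2 * k + 2) = \<Sum>{Suc k<..2 * Suc k} + Suc k"
      proof -
        have "{k<..2 * Suc k} = insert (2 * k + 2) (insert (2 * k + 1) {k<..2 * k})" by auto
        moreover have "{k<..2 * Suc k} = insert (Suc k) {Suc k<..2 * Suc k}" by auto
        ultimately have "\<Sum>(insert (2 * k + 2) (insert (2 * k + 1) {k<..2 * k})) = \<Sum>(insert (Suc k) {Suc k<..2 * Suc k})"
          by simp
        then show ?thesis by simp
      qed
      moreover have "neg_total (Suc k) = neg_total k + 3 * k + 1" "(\<Sum>i\<in>{1..<Suc k}. 2 * i) = (\<Sum>i\<in>{1..<k}. 2 * i) + 2 * k"
        using step by (simp_all add: neg_total_def)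
      moreover have "(Suc k)\<^sup>2 = k\<^sup>2 + 2 * k + 1" by (simp add: power2_eq_square)
      ultimately show ?case using step.IH by linarith
    qed
    moreover have "k\<^sup>2 \<ge> 1" using k by (simp add: Suc_le_eq)
    ultimately show ?thesis by linarith
  qed
  finally have gfP: "gf sum_mset (\<lambda>_. 1) ?P = fps_X ^ (neg_total k + 2) * (fps_X ^ (k\<^sup>2 - 1) *
      ((\<Prod>i\<in>{1..<k}. ?inv (2 * i)) * (\<Prod>i\<in>{k<..2 * k}. ?inv i)))"
    by (simp only: power_add mult.assoc)
  have "gf signed_weight (\<lambda>_. 1) (signed_data k) = gf sum_mset (\<lambda>_. 1) ?P * gf ?W (\<lambda>_. 1) (Pow {1..<k})"
    using gf_Times[OF P(1) T, of "\<lambda>_. 1" "\<lambda>_. 1"] by (simp add: signed_weight_def signed_data_def case_prod_unfold)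
  also have "\<dots> = fps_X ^ (neg_total k + 2) * (fps_X ^ (k\<^sup>2 - 1) *
      ((\<Prod>i\<in>{1..<k}. ?inv (2 * i) * (1 + fps_X ^ (3 * i))) * (\<Prod>i\<in>{k<..2 * k}. ?inv i)))"
    unfolding gfP gf_Pow[OF finite_atLeastLessThan] prod.distrib by (simp only: mult_ac)
  also have "(\<Prod>i\<in>{1..<k}. ?inv (2 * i) * (1 + fps_X ^ (3 * i))) = (\<Prod>i\<in>{1..<k}. ?inv i) * cubic_poly k"
    unfolding cubic_poly_def prod.distrib[symmetric] by (rule prod.cong) (auto intro!: inverse_factor_pair)
  also have "(\<Prod>i\<in>{1..<k}. ?inv i) * cubic_poly k * (\<Prod>i\<in>{k<..2 * k}. ?inv i) = signed_term k"
  proof -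
    have "inv_qpoch fps_X (2 * int k) = (\<Prod>i\<in>{1..2 * k}. ?inv i)"
      using inv_qpoch_nat[of fps_X "2 * k"] by (simp add: qpoch_def inverse_prod_fps)
    also have "\<dots> = (\<Prod>i\<in>{1..<k}. ?inv i) * (?inv k * (\<Prod>i\<in>{k<..2 * k}. ?inv i))"
      by (rule prod_split)
    finally have "signed_term k = ((1 - fps_X ^ k) * ?inv k) * ((\<Prod>i\<in>{1..<k}. ?inv i) * cubic_poly k * (\<Prod>i\<in>{k<..2 * k}. ?inv i))"
      unfolding signed_term_def by (simp only: mult_ac)
    then show ?thesis using inverse_one_minus_X_power[of k] k by simp
  qed
  finally show "gf signed_weight (\<lambda>_. 1) (signed_data k) = fps_X ^ (neg_total k + 2) * (fps_X ^ (k\<^sup>2 - 1) * signed_term k)" .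
qed

theorem theorem5p14:
  fixes n :: nat
  shows "finite {\<sigma>. signed_partition_of (int n + 2) \<sigma> \<and> admissible \<sigma>} \<and>
    card {\<sigma>. signed_partition_of (int n + 2) \<sigma> \<and> admissible \<sigma>} =
    card {p. partition_of n p \<and> (\<forall>x\<in>set p. allowed_part x)}"
proof -
  let ?A = "{\<sigma>. signed_partition_of (int n + 2) \<sigma> \<and> admissible \<sigma>}"
  let ?S = "Collect allowed_part"
  define B where "B k = {b \<in> signed_data k. signed_weight b = n + 2 + neg_total k}" for k
  have fin: "finite (B k)" if "k \<ge> 1" for k
    using gf_signed_data(1)[OF that] by (simp add: B_def fin_fibers_def)
  have card: "of_nat (card (B k)) = (fps_X ^ (k\<^sup>2 - 1) * signed_term k) $ n" if "k \<ge> 1" for k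
  proof -
    have "of_nat (card (B k)) = gf signed_weight (\<lambda>_. 1) (signed_data k) $ (n + 2 + neg_total k)"
      by (simp add: B_def gf_count)
    also have "\<dots> = (fps_X ^ (k\<^sup>2 - 1) * signed_term k) $ n"
      unfolding gf_signed_data(2)[OF that] fps_X_power_mult_nth[of "neg_total k + 2"] by simp
    finally show ?thesis .
  qed
  \<comment> \<open>Only finitely many largest parts occur: the series for \<open>k\<close> has order at least \<open>k\<^sup>2 - 1\<close>.\<close>
  have empty: "B k = {}" if "k > n + 1" for k
  proof -
    have "n < k\<^sup>2 - 1"
    proof -
      have "k * 2 \<le> k * k" using that by (intro mult_le_mono2) simp
      then show ?thesis using that unfolding power2_eq_square by linarith
    qed
    then have "card (B k) = 0" using card[of k] that by (simp add: fps_X_power_mult_nth)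
    then show ?thesis using fin[of k] that by simp
  qed
  have Sigma: "(SIGMA k:{1..}. B k) = (SIGMA k:{1..n + 1}. B k)"
    using empty by (force simp: not_le[symmetric])
  note bij = bij_signed_data[of n, folded B_def, unfolded Sigma]
  have "finite (SIGMA k:{1..n + 1}. B k)" using fin by auto
  then have finA: "finite ?A" using bij by (simp only: bij_betw_finite)
  have cardA: "card ?A = (\<Sum>k\<in>{1..n + 1}. card (B k))"
    using bij_betw_same_card[OF bij] fin by (simp add: card_SigmaI)
  have "eventually (\<lambda>L. (\<Sum>N\<in>{1..L}. fps_X ^ (N\<^sup>2 - 1) * signed_term N) $ n = inverse (euler_prod ?S) $ n) sequentially"
    using signed_series_product by (simp add: tendsto_fps_iff)
  moreover have "(\<lambda>N. inverse (\<Prod>i\<in>?S \<inter> {1..N}. 1 - fps_X ^ i)) \<longlonglongrightarrow> inverse (euler_prod ?S)"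
  proof (intro tendsto_inverse_fps tendsto_euler_prod)
    have S0: "0 \<notin> ?S" by (simp add: allowed_part_mod)
    then show "0 \<notin> ?S" .
    show "eventually (\<lambda>N. i \<in> ?S \<inter> {1..N}) sequentially" if "i \<in> ?S" for i
      using that S0 by (intro eventually_sequentiallyI[of i]) (auto simp: Suc_le_eq intro: gr0I)
  qed auto
  then have "eventually (\<lambda>N. inverse (\<Prod>i\<in>?S \<inter> {1..N}. 1 - fps_X ^ i) $ n = inverse (euler_prod ?S) $ n) sequentially"
    by (simp only: tendsto_fps_iff)
  ultimately have "eventually (\<lambda>L. L \<ge> n + 1
      \<and> (\<Sum>N\<in>{1..L}. fps_X ^ (N\<^sup>2 - 1) * signed_term N) $ n = inverse (\<Prod>i\<in>?S \<inter> {1..L}. 1 - fps_X ^ i) $ n) sequentially"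
    using eventually_ge_at_top[of "n + 1"] by eventually_elim simp
  \<comment> \<open>Both counts are read off at one common truncation.\<close>
  from eventually_happens'[OF sequentially_bot this] obtain L where L: "L \<ge> n + 1"
      "(\<Sum>N\<in>{1..L}. fps_X ^ (N\<^sup>2 - 1) * signed_term N) $ n = inverse (\<Prod>i\<in>?S \<inter> {1..L}. 1 - fps_X ^ i) $ n"
    by blast
  have "of_nat (card ?A) = (\<Sum>k\<in>{1..n + 1}. of_nat (card (B k)) :: complex)"
    unfolding cardA by simp
  also have "\<dots> = (\<Sum>k\<in>{1..L}. of_nat (card (B k)))"
    using L(1) empty by (intro sum.mono_neutral_left) auto
  also have "\<dots> = (\<Sum>N\<in>{1..L}. fps_X ^ (N\<^sup>2 - 1) * signed_term N) $ n"
    unfolding fps_sum_nth by (rule sum.cong) (simp_all add: card)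
  also have "\<dots> = of_nat (card {p. partition_of n p \<and> set p \<subseteq> ?S})"
    unfolding L(2) using L(1) by (intro card_partitions_into[symmetric]) (simp_all add: allowed_part_mod)
  also have "{p. partition_of n p \<and> set p \<subseteq> ?S} = {p. partition_of n p \<and> (\<forall>x\<in>set p. allowed_part x)}"
    by auto
  finally show ?thesis using finA by (simp only: of_nat_eq_iff)
qed

end
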